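(* For every $s\in\mathbb{C}$ with $\sigma=\operatorname{Re}(s)<0$, we have $$D(s)=\Gamma(1-s)\sum_{k=1}^{\infty}\ \sum_{\substack{\ell\in\mathbb{Z}\\ (k,\ell)\ne(1,0)}}(2\log k+2\pi i\ell)^{s-1},$$ where, as indicated, the term $(k,\ell)=(1,0)$ is omitted. The inner sum over $\ell$ converges absolutely for each $k$, and the outer sum over $k$ (of the values of the inner sums) converges absolutely. Equivalently, for $\sigma<0$, $$D(s)=\mathcal{X}(s)\,\zeta(1-s)+\Gamma(1-s)\sum_{k=2}^{\infty}\sum_{\ell\in\mathbb{Z}}(2\log k+2\pi i\ell)^{s-1}.$$
   Context: Here $\zeta$ is the Riemann zeta function. $D$ is the function given by $D(s)=\sum_{n\ge1}\zeta(2n)\,n^{-s}$ for $\operatorname{Re}(s)>1$, continued meromorphically to $\mathbb{C}$ by $D(s)=\zeta(s)+E(s)$, where $E(s)=\sum_{n\ge1}(\zeta(2n)-1)n^{-s}$ converges absolutely for all $s\in\mathbb{C}$ and is entire; the only singularity of $D$ is a simple pole at $s=1$. Complex powers are computed with the principal branch of the logarithm. $\mathcal{X}(s)=2^{s}\pi^{s-1}\sin(\pi s/2)\,\Gamma(1-s)$ is the factor in Riemann's functional equation $\zeta(s)=\mathcal{X}(s)\zeta(1-s)$. The double series is summed first over $\ell$ for each fixed $k$ and then over $k$; it is not absolutely convergent as a double series. *)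

theory Defs
  imports "HOL-Complex_Analysis.Complex_Analysis"
begin

text \<open>
  The continuation of a function \<open>F\<close>, given on the half-plane \<open>Re s > 1\<close>, to the complex plane
  without the point \<open>1\<close>. The total function is normalised by the value \<open>0\<close> at the (possible)
  pole \<open>1\<close>, which makes the described function unique.
\<close>

definition is_continuation :: "(complex \<Rightarrow> complex) \<Rightarrow> (complex \<Rightarrow> complex) \<Rightarrow> bool" where
  "is_continuation F f \<longleftrightarrow>
     f holomorphic_on - {1} \<and> (\<forall>s. Re s > 1 \<longrightarrow> f s = F s) \<and> f 1 = 0"

definition continuation :: "(complex \<Rightarrow> complex) \<Rightarrow> complex \<Rightarrow> complex" where
  "continuation F = (THE f. is_continuation F f)"

lemma is_continuation_unique:
  assumes "is_continuation F f" "is_continuation F g"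
  shows "f = g"
proof
  fix z :: complex
  show "f z = g z"
  proof (cases "z = 1")
    case True
    then show ?thesis using assms by (simp add: is_continuation_def)
  next
    case False
    have conn: "connected (- {1 :: complex})"
      by (rule connected_punctured_universe) simp
    have two: "2 \<in> {s. Re s > 1}" by simp
    show ?thesis
    proof (rule analytic_continuation_open[of "{s. Re s > 1}" "- {1}" f g z])
      show "{s. Re s > 1} \<noteq> {}" using two by blast
      show "open {s. Re s > 1}" by (rule open_halfspace_Re_gt)
    qed (use assms conn False in \<open>auto simp: is_continuation_def\<close>)
  qed
qed

lemma continuation_eqI: "is_continuation F f \<Longrightarrow> continuation F = f"
  unfolding continuation_def by (blast intro: is_continuation_unique)

definition riemann_zeta :: "complex \<Rightarrow> complex" where
  "riemann_zeta = continuation (\<lambda>s. \<Sum>n. of_nat (Suc n) powr (- s))"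

text \<open>
  The function \<open>D\<close> is the meromorphic continuation of \<open>\<Sum>n\<ge>1. \<zeta>(2n) n\<^sup>-\<^sup>s\<close>; since this series is
  \<open>\<zeta>(s) + E(s)\<close> with the entire function \<open>E(s) = \<Sum>n\<ge>1. (\<zeta>(2n) - 1) n\<^sup>-\<^sup>s\<close>, the continuation is
  \<open>\<zeta> + E\<close> (away from the pole \<open>1\<close>).
\<close>

definition D_fun :: "complex \<Rightarrow> complex" where
  "D_fun = continuation
     (\<lambda>s. \<Sum>n. riemann_zeta (2 * of_nat (Suc n)) * of_nat (Suc n) powr (- s))"

definition chi_factor :: "complex \<Rightarrow> complex" where
  "chi_factor s =
     2 powr s * of_real pi powr (s - 1) * sin (of_real pi * s / 2) * Gamma (1 - s)"

definition lattice_term :: "complex \<Rightarrow> nat \<Rightarrow> int \<Rightarrow> complex" where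
  "lattice_term s k l =
     (of_real (2 * ln (real k)) + 2 * of_real pi * \<i> * of_int l) powr (s - 1)"

definition inner_sum :: "complex \<Rightarrow> nat \<Rightarrow> complex" where
  "inner_sum s k = (\<Sum>\<^sub>\<infinity>l | (k, l) \<noteq> (1, 0). lattice_term s k l)"

end

theory Submission
  imports Defs "HOL-Real_Asymp.Real_Asymp"
begin

text \<open>
  The kernel \<open>g(x) = e\<^sup>-\<^sup>x / (1 - e\<^sup>-\<^sup>x)\<^sup>2\<close> equals both \<open>\<Sum>n\<ge>1. n e\<^sup>-\<^sup>n\<^sup>x\<close> and, by partial fractions,
  \<open>\<Sum>l. (x + 2\<pi>il)\<^sup>-\<^sup>2\<close>. For \<open>-1 < s < 0\<close> and \<open>w > 0\<close>, integrating \<open>u\<^sup>s g(w + u)\<close> over \<open>u > 0\<close> termwise in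
  both ways turns this into Lipschitz' formula
  \<open>\<Gamma>(1-s) \<Sum>l. (w + 2\<pi>il)\<^sup>s\<^sup>-\<^sup>1 = \<Sum>n\<ge>1. n\<^sup>-\<^sup>s e\<^sup>-\<^sup>n\<^sup>w\<close>, which extends to \<open>Re s < 0\<close> by analytic continuation.
  At \<open>w = 0\<close> the term \<open>u\<^sup>-\<^sup>2\<close> of \<open>l = 0\<close> has to be removed from \<open>g\<close>, and the Mellin transform of
  \<open>g(u) - u\<^sup>-\<^sup>2\<close> is the analytic continuation of that of \<open>g\<close>, namely \<open>\<Gamma>(1+s) \<zeta>(s)\<close>; this gives
  \<open>\<zeta>(s) = \<Gamma>(1-s) \<Sum>l\<noteq>0. (2\<pi>il)\<^sup>s\<^sup>-\<^sup>1\<close> and with it the continuation of \<open>\<zeta>\<close> to the whole plane.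
  Finally \<open>D = \<zeta> + E\<close> with \<open>E(s) = \<Sum>n\<ge>1. n\<^sup>-\<^sup>s \<Sum>k\<ge>2. k\<^sup>-\<^sup>2\<^sup>n\<close>; after exchanging the sums, the inner sum over
  \<open>n\<close> is given by Lipschitz' formula with \<open>w = 2 log k\<close>, while \<open>\<zeta>\<close> supplies the terms with \<open>k = 1\<close>.
\<close>

subsection \<open>Holomorphic integrals and series\<close>

text \<open>A local majorant of the integrand is enough for differentiating under the integral:
  Cauchy's inequality turns it into a majorant of the derivative on a smaller ball, the mean value
  inequality passes this on to the difference quotients, and dominated convergence along sequences
  does the rest.\<close>

lemma holomorphic_on_integral:
  fixes f :: "complex \<Rightarrow> 'a \<Rightarrow> complex"
  assumes S: "open S"
    and meas: "\<And>z. z \<in> S \<Longrightarrow> f z \<in> borel_measurable M"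
    and hol: "\<And>x. x \<in> space M \<Longrightarrow> (\<lambda>z. f z x) holomorphic_on S"
    and dom: "\<And>z. z \<in> S \<Longrightarrow> \<exists>r>0. \<exists>G. integrable M G \<and>
                (\<forall>y\<in>ball z r \<inter> S. \<forall>x\<in>space M. norm (f y x) \<le> G x)"
  shows "(\<lambda>z. \<integral>x. f z x \<partial>M) holomorphic_on S"
proof -
  have "\<exists>D. ((\<lambda>z. \<integral>x. f z x \<partial>M) has_field_derivative D) (at z)" if z: "z \<in> S" for z
  proof -
    obtain r0 G where r0: "r0 > 0" and G: "integrable M G"
      and fG: "\<And>y x. y \<in> ball z r0 \<inter> S \<Longrightarrow> x \<in> space M \<Longrightarrow> norm (f y x) \<le> G x"
      using dom[OF z] by blast
    obtain r1 where r1: "r1 > 0" "ball z r1 \<subseteq> S"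
      using S z openE by blast
    \<comment> \<open>Half of the smaller radius, so that a closed ball of radius \<open>r\<close>
      about any point of \<open>ball z r\<close> stays in \<open>ball z (2 * r)\<close>, where
      majorant and holomorphy are both available.\<close>
    define r where "r = min r0 r1 / 2"
    have r: "r > 0" using r0 r1 by (simp add: r_def)
    have sub: "ball z (2 * r) \<subseteq> ball z r0 \<inter> S"
    proof -
      have "ball z (2*r) \<subseteq> ball z r0" "ball z (2*r) \<subseteq> ball z r1"
        by (auto simp: r_def)
      then show ?thesis using r1 by blast
    qed
    have int: "integrable M (f y)" if "y \<in> ball z (2 * r)" for y
      by (rule Bochner_Integration.integrable_bound[OF G])
         (use that sub fG meas in \<open>auto intro!: AE_I2 order.trans[OF fG abs_ge_self]\<close>)
    have d: "((\<lambda>z. f z x) has_field_derivative deriv (\<lambda>z. f z x) y) (at y)"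
      if "y \<in> ball z (2 * r)" "x \<in> space M" for x y
      using holomorphic_derivI[OF hol[OF that(2)] S] sub that(1) by auto
    have dbound: "norm (deriv (\<lambda>z. f z x) y) \<le> G x / r"
      if y: "y \<in> ball z r" and x: "x \<in> space M" for x y
    proof -
      have "norm (deriv (\<lambda>z. f z x) y) = norm ((deriv ^^ 1) (\<lambda>z. f z x) y)" by simp
      also have "\<dots> \<le> fact 1 * G x / r ^ 1"
      proof (rule Cauchy_inequality)
        have sub2: "cball y r \<subseteq> ball z (2 * r)"
        proof
          fix w assume "w \<in> cball y r"
          with y show "w \<in> ball z (2*r)"
            using dist_triangle[of z w y] by auto
        qed
        then have sub3: "cball y r \<subseteq> S" using sub by blast
        show "(\<lambda>z. f z x) holomorphic_on ball y r"
          by (rule holomorphic_on_subset[OF hol[OF x]]) (use sub3 ball_subset_cball in blast)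
        show "continuous_on (cball y r) (\<lambda>z. f z x)"
          by (rule holomorphic_on_imp_continuous_on[OF holomorphic_on_subset[OF hol[OF x] sub3]])
        show "norm (f w x) \<le> G x" if "norm (y - w) = r" for w
        proof (rule fG[OF _ x])
          have "w \<in> cball y r" using that by (simp add: dist_norm)
          then show "w \<in> ball z r0 \<inter> S" using sub2 sub by blast
        qed
      qed (use r in auto)
      finally show ?thesis by simp
    qed
    define D where "D = (\<integral>x. deriv (\<lambda>z. f z x) z \<partial>M)"
    have "((\<lambda>y. ((\<integral>x. f y x \<partial>M) - (\<integral>x. f z x \<partial>M)) / (y - z)) \<longlongrightarrow> D) (at z)"
      unfolding tendsto_at_iff_sequentially
    proof (intro allI impI)
      fix X assume X: "\<forall>i. X i \<in> UNIV - {z}" "X \<longlonglongrightarrow> z"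
      obtain N where N: "\<And>n. n \<ge> N \<Longrightarrow> X n \<in> ball z r"
        using topological_tendstoD[OF X(2), of "ball z r"] r
        by (auto simp: eventually_sequentially)
      define Y where "Y n = X (n + N)" for n
      have Y: "Y n \<in> ball z r" "Y n \<noteq> z" for n
        using X N by (auto simp: Y_def)
      have Y2: "Y n \<in> ball z (2 * r)" for n using Y(1)[of n] r by auto
      have Ylim: "Y \<longlonglongrightarrow> z" unfolding Y_def by (rule LIMSEQ_ignore_initial_segment[OF X(2)])
      have zz: "z \<in> ball z (2*r)" using r by simp
      define q where "q n x = (f (Y n) x - f z x) / (Y n - z)" for n x
      have qlim: "(\<lambda>n. q n x) \<longlonglongrightarrow> deriv (\<lambda>z. f z x) z" if "x \<in> space M" for x
      proof -
        have "((\<lambda>y. (f y x - f z x) / (y - z)) \<longlongrightarrow> deriv (\<lambda>z. f z x) z) (at z)"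
          using d[OF zz that] by (simp add: has_field_derivative_iff)
        then show ?thesis
          unfolding tendsto_at_iff_sequentially using Y Ylim
          by (auto simp: q_def o_def)
      qed
      have qmeas: "q n \<in> borel_measurable M" for n
        using meas[of z] meas[of "Y n"] Y2[of n] sub z unfolding q_def by auto
      have "(\<lambda>n. \<integral>x. q n x \<partial>M) \<longlonglongrightarrow> D"
        unfolding D_def
      proof (rule integral_dominated_convergence[where w = "\<lambda>x. G x / r"])
        \<comment> \<open>Measurability of the derivative in \<open>x\<close> is inherited from the
          difference quotients, of which it is the pointwise limit.\<close>
        show "(\<lambda>x. deriv (\<lambda>z. f z x) z) \<in> borel_measurable M"
          by (rule borel_measurable_LIMSEQ_metric[OF qmeas qlim])
        show "integrable M (\<lambda>x. G x / r)" using G by simp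
        show "AE x in M. (\<lambda>n. q n x) \<longlonglongrightarrow> deriv (\<lambda>z. f z x) z"
          using qlim by auto
        show "AE x in M. norm (q n x) \<le> G x / r" for n
        proof (rule AE_I2)
          fix x assume x: "x \<in> space M"
          have "norm (f (Y n) x - f z x) \<le> G x / r * norm (Y n - z)"
          proof (rule field_differentiable_bound[of "ball z r"])
            show "((\<lambda>z. f z x) has_field_derivative deriv (\<lambda>z. f z x) y) (at y within ball z r)"
              if "y \<in> ball z r" for y
              by (rule has_field_derivative_at_within[OF d[OF _ x]]) (use that r in auto)
          qed (use Y dbound x r in auto)
          then show "norm (q n x) \<le> G x / r"
            using Y(2)[of n] by (simp add: q_def norm_divide pos_divide_le_eq)
        qed
      qed (use qmeas in auto)
      moreover have "(\<integral>x. q n x \<partial>M) = ((\<integral>x. f (Y n) x \<partial>M) - (\<integral>x. f z x \<partial>M)) / (Y n - z)" for n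
        using int[OF Y2] int[OF zz] by (simp add: q_def)
      ultimately have "(\<lambda>n. ((\<integral>x. f (Y n) x \<partial>M) - (\<integral>x. f z x \<partial>M)) / (Y n - z)) \<longlonglongrightarrow> D"
        by simp
      then show "((\<lambda>y. ((\<integral>x. f y x \<partial>M) - (\<integral>x. f z x \<partial>M)) / (y - z)) \<circ> X) \<longlonglongrightarrow> D"
        unfolding Y_def o_def by (rule LIMSEQ_offset)
    qed
    then show ?thesis
      by (auto simp: has_field_derivative_iff)
  qed
  then show ?thesis
    by (auto simp: holomorphic_on_def field_differentiable_def intro: has_field_derivative_at_within)
qed

lemma infsum_eq_integral_count_space:
  fixes f :: "'a \<Rightarrow> 'b::{banach, second_countable_topology}"
  assumes "(\<lambda>i. norm (f i)) summable_on I"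
  shows "infsum f I = (\<integral>i. f i \<partial>count_space I)"
  using infsetsum_infsum[of f I] assms abs_summable_equivalent[of f I]
  by (simp add: infsetsum_def)

lemma integrable_count_space_iff_summable_on:
  fixes f :: "'a \<Rightarrow> 'b::{banach, second_countable_topology}"
  shows "integrable (count_space I) f \<longleftrightarrow> (\<lambda>i. norm (f i)) summable_on I"
  using abs_summable_equivalent[of f I] by (simp add: Infinite_Set_Sum.abs_summable_on_def)

text \<open>A series is an integral over the counting measure, so this is
  \<open>holomorphic_on_integral\<close> for \<open>count_space I\<close>.\<close>

lemma holomorphic_on_infsum:
  fixes f :: "complex \<Rightarrow> 'a \<Rightarrow> complex"
  assumes S: "open S"
    and hol: "\<And>i. i \<in> I \<Longrightarrow> (\<lambda>z. f z i) holomorphic_on S"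
    and dom: "\<And>z. z \<in> S \<Longrightarrow> \<exists>r>0. \<exists>G. G summable_on I \<and>
                (\<forall>y\<in>ball z r \<inter> S. \<forall>i\<in>I. norm (f y i) \<le> G i)"
  shows "(\<lambda>z. \<Sum>\<^sub>\<infinity>i\<in>I. f z i) holomorphic_on S"
proof -
  have *: "(\<lambda>i. norm (f z i)) summable_on I" if z: "z \<in> S" for z
  proof -
    obtain r G where r: "r > 0" "G summable_on I" "\<forall>y\<in>ball z r \<inter> S. \<forall>i\<in>I. norm (f y i) \<le> G i"
      using dom[OF z] by blast
    show ?thesis
      by (rule summable_on_comparison_test[OF r(2)]) (use r z in auto)
  qed
  have "(\<lambda>z. \<integral>i. f z i \<partial>count_space I) holomorphic_on S"
  proof (rule holomorphic_on_integral[OF S])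
    fix z assume z: "z \<in> S"
    then obtain r G where r: "r > 0" "G summable_on I" "\<forall>y\<in>ball z r \<inter> S. \<forall>i\<in>I. norm (f y i) \<le> G i"
      using dom by blast
    have "(\<lambda>i. norm (G i)) summable_on I"
      using r(2) summable_on_iff_abs_summable_on_real by auto
    then show "\<exists>r>0. \<exists>G. integrable (count_space I) G \<and>
                (\<forall>y\<in>ball z r \<inter> S. \<forall>x\<in>space (count_space I). norm (f y x) \<le> G x)"
      using r by (auto simp: integrable_count_space_iff_summable_on)
  qed (use hol in auto)
  then show ?thesis
    by (rule holomorphic_transform) (use * in \<open>simp add: infsum_eq_integral_count_space\<close>)
qed

text \<open>Fubini for the product of the counting measure with \<open>M\<close>. Countability of
  \<open>I\<close> makes the counting measure sigma-finite and gives joint measurability; pointwise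
  absolute summability identifies the inner series with an integral over the counting
  measure.\<close>

lemma infsum_integral:
  fixes f :: "'i \<Rightarrow> 'a \<Rightarrow> 'b::{banach, second_countable_topology}"
  assumes "sigma_finite_measure M" "countable I"
    and int: "\<And>i. i \<in> I \<Longrightarrow> integrable M (f i)"
    and sum: "(\<lambda>i. \<integral>x. norm (f i x) \<partial>M) summable_on I"
    and abs: "\<And>x. x \<in> space M \<Longrightarrow> (\<lambda>i. norm (f i x)) summable_on I"
  shows "(\<Sum>\<^sub>\<infinity>i\<in>I. \<integral>x. f i x \<partial>M) = (\<integral>x. (\<Sum>\<^sub>\<infinity>i\<in>I. f i x) \<partial>M)"
proof -
  interpret M: sigma_finite_measure M by fact
  interpret C: sigma_finite_measure "count_space I"
    by (rule sigma_finite_measure_count_space_countable) fact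
  interpret P: pair_sigma_finite "count_space I" M ..
  have fm [measurable]: "(\<lambda>(i, x). f i x) \<in> borel_measurable (count_space I \<Otimes>\<^sub>M M)"
    using int \<open>countable I\<close> by (auto intro!: measurable_pair_measure_countable1)
  have prod: "integrable (count_space I \<Otimes>\<^sub>M M) (\<lambda>(i, x). f i x)"
  proof (rule P.Fubini_integrable)
    show "integrable (count_space I) (\<lambda>i. \<integral>x. norm (case (i, x) of (i, x) \<Rightarrow> f i x) \<partial>M)"
      using sum by (simp add: integrable_count_space_iff_summable_on)
  qed (use int fm in \<open>auto simp: AE_count_space\<close>)
  have eq: "(\<integral>i. f i x \<partial>count_space I) = (\<Sum>\<^sub>\<infinity>i\<in>I. f i x)" if "x \<in> space M" for x
    using infsum_eq_integral_count_space abs[OF that] by metis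
  have "(\<Sum>\<^sub>\<infinity>i\<in>I. \<integral>x. f i x \<partial>M) = (\<integral>i. \<integral>x. f i x \<partial>M \<partial>count_space I)"
    by (rule infsum_eq_integral_count_space, rule summable_on_comparison_test[OF sum])
       (auto intro: integral_norm_bound)
  also have "\<dots> = (\<integral>x. \<integral>i. f i x \<partial>count_space I \<partial>M)"
    using P.Fubini_integral[OF prod] by simp
  also have "\<dots> = (\<integral>x. (\<Sum>\<^sub>\<infinity>i\<in>I. f i x) \<partial>M)"
    by (rule Bochner_Integration.integral_cong) (use eq in auto)
  finally show "(\<Sum>\<^sub>\<infinity>i\<in>I. \<integral>x. f i x \<partial>M) = (\<integral>x. (\<Sum>\<^sub>\<infinity>i\<in>I. f i x) \<partial>M)" .
qed

text \<open>The form of the identity theorem by which every formula below passes from real to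
  complex arguments: an interior point of the segment is a limit point of it.\<close>

lemma analytic_continuation_real_segment:
  assumes S: "open S" "connected S" and f: "f holomorphic_on S" and g: "g holomorphic_on S"
    and ab: "a < b" and sub: "\<And>x. a < x \<Longrightarrow> x < b \<Longrightarrow> of_real x \<in> S"
    and eq: "\<And>x. a < x \<Longrightarrow> x < b \<Longrightarrow> f (of_real x) = g (of_real x)"
    and w: "w \<in> S"
  shows "f w = g w"
proof -
  let ?U = "of_real ` {a<..<b} :: complex set"
  obtain c where c: "a < c" "c < b" using dense[OF ab] by blast
  have "c islimpt {a<..<b}" using c by (intro open_imp_islimpt) auto
  then have "of_real c islimpt ?U"
    by (rule islimpt_isCont_image) (auto simp: eventually_at_filter)
  moreover have "(\<lambda>z. f z - g z) holomorphic_on S" by (intro holomorphic_intros f g)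
  ultimately have "f w - g w = 0"
    using S sub[OF c] sub eq w by (intro analytic_continuation[of "\<lambda>z. f z - g z" S ?U "of_real c" w]) auto
  then show ?thesis by simp
qed

subsection \<open>Gamma and Beta integrals over the half-line\<close>

text \<open>With the half-line as the space of the measure, pointwise conditions have to be checked
  at positive arguments only and integrands carry no indicator functions.\<close>

abbreviation half_line :: "real measure" where
  "half_line \<equiv> restrict_space lborel {0<..}"

lemma sigma_finite_half_line: "sigma_finite_measure half_line"
  by (rule sigma_finite_measure_restrict_space) (auto intro: lborel.sigma_finite_measure_axioms)

lemma space_half_line [simp]: "space half_line = {0<..}"
  by (simp add: space_restrict_space)

text \<open>Euler's integral after the substitution of \<open>x * t\<close> for the variable. The
  nonnegative integral is taken first because its finite value later yields integrability and the
  Lebesgue integral together.\<close>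

lemma nn_integral_half_line_Gamma:
  assumes a: "a > 0" and x: "x > (0::real)"
  shows "(\<integral>\<^sup>+t. ennreal (t powr (a - 1) * exp (- (x * t))) \<partial>half_line) = ennreal (Gamma a * x powr (- a))"
proof -
  have "ennreal (Gamma a) = (\<integral>\<^sup>+t. ennreal (indicator {0..} t * t powr (a - 1) / exp t) \<partial>lborel)"
    by (rule Gamma_conv_nn_integral_real[OF a])
  also have "\<dots> = \<bar>x\<bar> * (\<integral>\<^sup>+t. ennreal (indicator {0..} (0 + x * t) * (0 + x * t) powr (a - 1) / exp (0 + x * t)) \<partial>lborel)"
    by (rule nn_integral_real_affine) (use x in auto)
  also have "(\<integral>\<^sup>+t. ennreal (indicator {0..} (0 + x * t) * (0 + x * t) powr (a - 1) / exp (0 + x * t)) \<partial>lborel)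
     = (\<integral>\<^sup>+t. ennreal (x powr (a - 1)) * (ennreal (t powr (a - 1) * exp (- (x * t))) * indicator {0<..} t) \<partial>lborel)"
  proof (rule nn_integral_cong)
    fix t :: real
    show "ennreal (indicator {0..} (0 + x * t) * (0 + x * t) powr (a - 1) / exp (0 + x * t)) =
      ennreal (x powr (a - 1)) * (ennreal (t powr (a - 1) * exp (- (x * t))) * indicator {0<..} t)"
      using x by (cases "t > 0"; cases "t = 0")
        (auto simp: powr_mult exp_minus field_simps zero_le_mult_iff indicator_def simp flip: ennreal_mult)
  qed
  also have "\<dots> = ennreal (x powr (a - 1)) * (\<integral>\<^sup>+t. ennreal (t powr (a - 1) * exp (- (x * t))) * indicator {0<..} t \<partial>lborel)"
    by (rule nn_integral_cmult) simp
  also have "(\<integral>\<^sup>+t. ennreal (t powr (a - 1) * exp (- (x * t))) * indicator {0<..} t \<partial>lborel)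
     = (\<integral>\<^sup>+t. ennreal (t powr (a - 1) * exp (- (x * t))) \<partial>half_line)" (is "_ = ?I")
    by (subst nn_integral_restrict_space) auto
  finally have *: "ennreal (Gamma a) = ennreal \<bar>x\<bar> * (ennreal (x powr (a - 1)) * ?I)" .
  have "ennreal \<bar>x\<bar> * (ennreal (x powr (a - 1)) * ?I) = ennreal (x powr a) * ?I"
    using x by (simp add: powr_diff flip: mult.assoc ennreal_mult)
  with * have "ennreal (x powr (- a)) * ennreal (Gamma a) = ennreal (x powr (-a)) * (ennreal (x powr a) * ?I)"
    by simp
  also have "\<dots> = ?I"
    using x by (simp add: powr_minus flip: mult.assoc ennreal_mult)
  finally show ?thesis using x a Gamma_real_pos[OF a]
    by (simp add: mult.commute flip: ennreal_mult)
qed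

text \<open>Write (x + u)^(-2) as the integral of t e^(-(x+u)t) over t > 0 and exchange the
  integrals by Tonelli; the integral over u and then the one over t are Gamma integrals.\<close>

lemma nn_integral_half_line_Beta:
  assumes b: "0 < b" "b < 2" and x: "x > (0::real)"
  shows "(\<integral>\<^sup>+u. ennreal (u powr (b - 1) / (x + u) ^ 2) \<partial>half_line)
           = ennreal (Gamma b * Gamma (2 - b) * x powr (b - 2))"
proof -
  interpret H: sigma_finite_measure half_line by (rule sigma_finite_half_line)
  interpret P: pair_sigma_finite half_line half_line ..
  have "(\<integral>\<^sup>+u. ennreal (u powr (b - 1) / (x + u) ^ 2) \<partial>half_line)
      = (\<integral>\<^sup>+u. (\<integral>\<^sup>+t. ennreal (u powr (b - 1) * (t * exp (- ((x + u) * t)))) \<partial>half_line) \<partial>half_line)"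
  proof (rule nn_integral_cong)
    fix u :: real assume "u \<in> space half_line"
    then have u: "u > 0" by simp
    have "(\<integral>\<^sup>+t. ennreal (u powr (b - 1) * (t * exp (- ((x + u) * t)))) \<partial>half_line)
      = (\<integral>\<^sup>+t. ennreal (u powr (b - 1)) * ennreal (t powr (2 - 1) * exp (- ((x + u) * t))) \<partial>half_line)"
      by (rule nn_integral_cong) (auto simp flip: ennreal_mult)
    also have "\<dots> = ennreal (u powr (b - 1)) * ennreal (Gamma 2 * (x + u) powr (- 2))"
      using nn_integral_half_line_Gamma[of 2 "x + u"] x u
      by (subst nn_integral_cmult) (auto intro!: measurable_restrict_space1)
    also have "\<dots> = ennreal (u powr (b - 1) / (x + u) ^ 2)"
      using x u by (simp add: Gamma_numeral powr_minus powr_numeral field_simps flip: ennreal_mult)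
    finally show "ennreal (u powr (b - 1) / (x + u) ^ 2)
      = (\<integral>\<^sup>+t. ennreal (u powr (b - 1) * (t * exp (- ((x + u) * t)))) \<partial>half_line)" by simp
  qed
  also have "\<dots> = (\<integral>\<^sup>+t. (\<integral>\<^sup>+u. ennreal (u powr (b - 1) * (t * exp (- ((x + u) * t)))) \<partial>half_line) \<partial>half_line)"
  proof (rule P.Fubini')
    have id [measurable]: "(\<lambda>x. x) \<in> borel_measurable half_line" by (simp add: measurable_restrict_space1)
    show "(\<lambda>(u, t). ennreal (t powr (b - 1) * (u * exp (- ((x + t) * u)))))
            \<in> borel_measurable (half_line \<Otimes>\<^sub>M half_line)"
      using measurable_compose[OF measurable_fst id] measurable_compose[OF measurable_snd id]
      by (simp add: case_prod_unfold)
  qed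
  also have "\<dots> = (\<integral>\<^sup>+t. ennreal (Gamma b) * ennreal (t powr (2 - b - 1) * exp (- (x * t))) \<partial>half_line)"
  proof (rule nn_integral_cong)
    fix t :: real assume "t \<in> space half_line"
    then have t: "t > 0" by simp
    have "(\<integral>\<^sup>+u. ennreal (u powr (b - 1) * (t * exp (- ((x + u) * t)))) \<partial>half_line)
      = (\<integral>\<^sup>+u. ennreal (t * exp (- (x * t))) * ennreal (u powr (b - 1) * exp (- (t * u))) \<partial>half_line)"
      by (rule nn_integral_cong) (use t in \<open>auto simp: algebra_simps exp_diff exp_minus exp_add divide_simps simp flip: ennreal_mult\<close>)
    also have "\<dots> = ennreal (t * exp (- (x * t))) * ennreal (Gamma b * t powr (- b))"
      using nn_integral_half_line_Gamma[of b t] b t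
      by (subst nn_integral_cmult) (auto intro!: measurable_restrict_space1)
    also have "\<dots> = ennreal (Gamma b) * ennreal (t powr (2 - b - 1) * exp (- (x * t)))"
      using t b Gamma_real_pos[of b] by (simp add: powr_diff powr_minus field_simps flip: ennreal_mult)
    finally show "(\<integral>\<^sup>+u. ennreal (u powr (b - 1) * (t * exp (- ((x + u) * t)))) \<partial>half_line) = \<dots>" .
  qed
  also have "\<dots> = ennreal (Gamma b) * ennreal (Gamma (2 - b) * x powr (- (2 - b)))"
    using nn_integral_half_line_Gamma[of "2 - b" x] b x
    by (subst nn_integral_cmult) (auto intro!: measurable_restrict_space1)
  also have "\<dots> = ennreal (Gamma b * Gamma (2 - b) * x powr (b - 2))"
    using b Gamma_real_pos[of b] Gamma_real_pos[of "2 - b"] by (simp add: mult.assoc flip: ennreal_mult)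
  finally show ?thesis .
qed

lemma
  assumes a: "a > 0" and x: "x > (0::real)"
  shows integrable_half_line_Gamma: "integrable half_line (\<lambda>t. t powr (a - 1) * exp (- (x * t)))"
    and integral_half_line_Gamma: "(\<integral>t. t powr (a - 1) * exp (- (x * t)) \<partial>half_line) = Gamma a * x powr (- a)"
proof -
  have "Gamma a * x powr (- a) \<ge> 0" using Gamma_real_pos[OF a] by simp
  then have "integrable half_line (\<lambda>t. t powr (a - 1) * exp (- (x * t))) \<and>
    (\<integral>t. t powr (a - 1) * exp (- (x * t)) \<partial>half_line) = Gamma a * x powr (- a)"
    using nn_integral_half_line_Gamma[OF assms]
    by (subst (asm) nn_integral_eq_integrable) (auto intro!: measurable_restrict_space1)
  then show "integrable half_line (\<lambda>t. t powr (a - 1) * exp (- (x * t)))"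
    and "(\<integral>t. t powr (a - 1) * exp (- (x * t)) \<partial>half_line) = Gamma a * x powr (- a)" by auto
qed

lemma
  assumes b: "0 < b" "b < 2" and x: "x > (0::real)"
  shows integrable_half_line_Beta: "integrable half_line (\<lambda>u. u powr (b - 1) / (x + u) ^ 2)"
    and integral_half_line_Beta: "(\<integral>u. u powr (b - 1) / (x + u) ^ 2 \<partial>half_line) = Gamma b * Gamma (2 - b) * x powr (b - 2)"
proof -
  have "Gamma b * Gamma (2 - b) * x powr (b - 2) \<ge> 0"
    using Gamma_real_pos[of b] Gamma_real_pos[of "2 - b"] b by simp
  then have "integrable half_line (\<lambda>u. u powr (b - 1) / (x + u) ^ 2) \<and>
    (\<integral>u. u powr (b - 1) / (x + u) ^ 2 \<partial>half_line) = Gamma b * Gamma (2 - b) * x powr (b - 2)"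
    using nn_integral_half_line_Beta[OF assms]
    by (subst (asm) nn_integral_eq_integrable) (auto intro!: measurable_restrict_space1)
  then show "integrable half_line (\<lambda>u. u powr (b - 1) / (x + u) ^ 2)"
    and "(\<integral>u. u powr (b - 1) / (x + u) ^ 2 \<partial>half_line) = Gamma b * Gamma (2 - b) * x powr (b - 2)" by auto
qed

text \<open>A ball of radius \<open>e\<close> about \<open>z\<close> misses the slit, so
  \<open>z\<close> is at distance at least \<open>e\<close> from each point -u; moving
  \<open>z\<close> by less than \<open>e / 2\<close> leaves \<open>e / 2\<close>. The bound is
  uniform in u, as a majorant requires.\<close>

lemma slit_plane_ball:
  fixes z :: complex
  assumes "z \<notin> \<real>\<^sub>\<le>\<^sub>0"
  obtains r where "r > 0" "\<And>y u. y \<in> ball z r \<Longrightarrow> u \<ge> 0 \<Longrightarrow> r \<le> norm (y + of_real u)"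
proof -
  have "open (- \<real>\<^sub>\<le>\<^sub>0 :: complex set)" by (simp add: closed_nonpos_Reals_complex open_Compl)
  from openE[OF this, of z] assms obtain e where e: "e > 0" "ball z e \<subseteq> - \<real>\<^sub>\<le>\<^sub>0"
    by auto
  show thesis
  proof (rule that[of "e / 2"])
    fix y u assume y: "y \<in> ball z (e/2)" and u: "u \<ge> (0::real)"
    have "- of_real u \<in> (\<real>\<^sub>\<le>\<^sub>0 :: complex set)" using u by (simp add: complex_nonpos_Reals_iff)
    then have "dist z (- of_real u) \<ge> e" using e(2) by (force simp: not_less)
    moreover have "dist z (- of_real u) \<le> dist z y + norm (y + of_real u)"
      using dist_triangle[of z "- of_real u" y] by (simp add: dist_norm)
    ultimately show "e / 2 \<le> norm (y + of_real u)" using y by auto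
  qed (use e in auto)
qed

text \<open>Both sides of the evaluation are holomorphic in \<open>z\<close> off the slit and agree
  on a real segment by the real Beta integral.\<close>

lemma
  fixes z :: complex
  assumes b: "0 < b" "b < 2" and z: "z \<notin> \<real>\<^sub>\<le>\<^sub>0"
  shows integrable_half_line_Beta_complex: 
      "integrable half_line (\<lambda>u. of_real (u powr (b - 1)) / (z + of_real u) ^ 2)"
    and integral_half_line_Beta_complex: 
      "(\<integral>u. of_real (u powr (b - 1)) / (z + of_real u) ^ 2 \<partial>half_line)
         = of_real (Gamma b * Gamma (2 - b)) * z powr of_real (b - 2)"
proof -
  let ?S = "- \<real>\<^sub>\<le>\<^sub>0 :: complex set"
  let ?f = "\<lambda>z u. complex_of_real (u powr (b - 1)) / (z + of_real u) ^ 2"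
  have opn: "open ?S" by (simp add: closed_nonpos_Reals_complex open_Compl)
  have meas: "?f z \<in> borel_measurable half_line" for z
    by (auto intro!: measurable_restrict_space1)
  have dom: "\<exists>r>0. \<exists>G. integrable half_line G \<and>
                (\<forall>y\<in>ball z r. \<forall>u\<in>{0<..}. norm (?f y u) \<le> G u)" if z: "z \<notin> \<real>\<^sub>\<le>\<^sub>0" for z
  proof -
    obtain r where r: "r > 0" "\<And>y u. y \<in> ball z r \<Longrightarrow> u \<ge> 0 \<Longrightarrow> r \<le> norm (y + of_real u)"
      using slit_plane_ball[OF z] by blast
    \<comment> \<open>Chosen so that 1 + u \<le> K |y + u|: the left side is at most |y + u| + (1 +
      |z| + r), and |y + u| \<ge> r turns the constant into a multiple of |y + u|. The majorant is
      then a real Beta integrand at x = 1.\<close>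
    define K where "K = 1 + (1 + norm z + r) / r"
    have K: "K > 0" using r by (simp add: K_def add_pos_nonneg)
    have "norm (?f y u) \<le> K\<^sup>2 * (u powr (b - 1) / (1 + u) ^ 2)" if y: "y \<in> ball z r" and u: "u > 0" for y u
    proof -
      have ru: "r \<le> norm (y + of_real u)" using r y u by simp
      have "u = norm ((y + of_real u) - y)" using u by simp
      also have "\<dots> \<le> norm (y + of_real u) + norm y" by (rule norm_triangle_ineq4)
      also have "norm y \<le> norm z + r"
        using y norm_triangle_ineq3[of y z] by (simp add: dist_norm norm_minus_commute)
      finally have "1 + u \<le> norm (y + of_real u) + (1 + norm z + r) * 1" by simp
      also have "\<dots> \<le> norm (y + of_real u) + (1 + norm z + r) * (norm (y + of_real u) / r)"
        using ru r by (intro add_left_mono mult_left_mono) (auto simp: add_nonneg_nonneg)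
      also have "\<dots> = K * norm (y + of_real u)" using r by (simp add: K_def field_simps)
      finally have "(1 + u)\<^sup>2 \<le> (K * norm (y + of_real u))\<^sup>2" using u by (intro power_mono) auto
      moreover have "norm (y + of_real u) > 0" using ru r by linarith
      ultimately have "1 / (norm (y + of_real u))\<^sup>2 \<le> K\<^sup>2 * (1 / (1 + u)\<^sup>2)"
        using u by (simp add: field_simps power_mult_distrib)
      then have "u powr (b - 1) * (1 / (norm (y + of_real u))\<^sup>2) \<le> u powr (b - 1) * (K\<^sup>2 * (1 / (1 + u)\<^sup>2))"
        by (intro mult_left_mono) auto
      then show ?thesis by (simp add: norm_divide norm_power mult_ac)
    qed
    moreover have "integrable half_line (\<lambda>u. K\<^sup>2 * (u powr (b - 1) / (1 + u) ^ 2))"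
      by (intro integrable_mult_right integrable_half_line_Beta b) simp
    ultimately show ?thesis using r(1)
      by (intro exI[of _ r] exI[of _ "\<lambda>u. K\<^sup>2 * (u powr (b - 1) / (1 + u) ^ 2)"] conjI ballI) auto
  qed
  have int: "integrable half_line (?f z)" if z: "z \<notin> \<real>\<^sub>\<le>\<^sub>0" for z
  proof -
    from dom[OF z] obtain r G where r: "r > 0" and G: "integrable half_line G"
      and le: "\<forall>y\<in>ball z r. \<forall>u\<in>{0<..}. norm (?f y u) \<le> G u"
      by (elim exE conjE)
    show ?thesis
    proof (rule Bochner_Integration.integrable_bound[OF G meas AE_I2])
      fix u assume "u \<in> space half_line"
      then have "norm (?f z u) \<le> G u"
        by (intro le[rule_format]) (use r in auto)
      then show "norm (?f z u) \<le> norm (G u)" by simp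
    qed
  qed
  show "integrable half_line (?f z)" using int[OF z] .
  have hol: "(\<lambda>z. \<integral>u. ?f z u \<partial>half_line) holomorphic_on ?S"
  proof (rule holomorphic_on_integral[OF opn meas])
    fix u assume "u \<in> space half_line"
    then have "z + of_real u \<noteq> 0" if "z \<in> ?S" for z
      using that by (auto simp: complex_nonpos_Reals_iff complex_eq_iff)
    then show "(\<lambda>z. ?f z u) holomorphic_on ?S"
      by (intro holomorphic_intros) auto
  next
    fix z assume "z \<in> ?S"
    then have "z \<notin> \<real>\<^sub>\<le>\<^sub>0" by simp
    from dom[OF this] obtain r G where "r > 0" "integrable half_line G"
      and le: "\<forall>y\<in>ball z r. \<forall>u\<in>{0<..}. norm (?f y u) \<le> G u"
      by (elim exE conjE)
    then show "\<exists>r>0. \<exists>G. integrable half_line G \<and>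
                (\<forall>y\<in>ball z r \<inter> ?S. \<forall>u\<in>space half_line. norm (?f y u) \<le> G u)"
      by (intro exI[of _ r] exI[of _ G] conjI ballI le[rule_format]) simp_all
  qed
  have conn: "connected ?S"
  proof -
    have "?S = - of_real ` {..0}"
      by (auto simp: complex_nonpos_Reals_iff complex_eq_iff image_iff)
    then show ?thesis
      using starlike_imp_connected[OF starlike_slotted_complex_plane_left[of 0]] by simp
  qed
  show "(\<integral>u. ?f z u \<partial>half_line) = of_real (Gamma b * Gamma (2 - b)) * z powr of_real (b - 2)"
  proof (rule analytic_continuation_real_segment[OF opn conn hol, where a = 1 and b = 2
        and g = "\<lambda>z. of_real (Gamma b * Gamma (2 - b)) * z powr of_real (b - 2)" and w = z])
    show "z \<in> ?S" using z by simp
    show "of_real x \<in> ?S" if "1 < x" "x < 2" for x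
      using that by (simp add: complex_nonpos_Reals_iff)
    show "(\<lambda>z. of_real (Gamma b * Gamma (2 - b)) * z powr of_real (b - 2)) holomorphic_on ?S"
      by (intro holomorphic_intros) auto
    fix x :: real assume x: "1 < x" "x < 2"
    have "(\<integral>u. ?f (of_real x) u \<partial>half_line)
        = (\<integral>u. complex_of_real (u powr (b - 1) / (x + u) ^ 2) \<partial>half_line)"
      by (rule Bochner_Integration.integral_cong) auto
    also have "\<dots> = of_real (Gamma b * Gamma (2 - b) * x powr (b - 2))"
      unfolding integral_complex_of_real using integral_half_line_Beta[OF b, of x] x by simp
    also have "\<dots> = of_real (Gamma b * Gamma (2 - b)) * of_real x powr of_real (b - 2)"
      using x by (simp only: of_real_mult powr_of_real)
    finally show "(\<integral>u. ?f (of_real x) u \<partial>half_line)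
      = of_real (Gamma b * Gamma (2 - b)) * of_real x powr of_real (b - 2)" .
  qed simp
qed

subsection \<open>The partial fraction expansion of the kernel\<close>

text \<open>The logarithmic derivative of Gamma(w) Gamma(1 - w) = pi / sin(pi w) gives
  \<open>Digamma w - Digamma (1 - w)\<close> as a cotangent; differentiating once more gives the
  square of the cosecant.\<close>

lemma Polygamma_1_reflection:
  fixes z :: complex
  assumes z: "z \<notin> \<int>"
  shows "Polygamma 1 z + Polygamma 1 (1 - z) = (of_real pi / sin (of_real pi * z))\<^sup>2"
proof -
  let ?S = "- \<int> :: complex set"
  have opn: "open ?S" by (simp add: open_Compl)
  have nz: "sin (of_real pi * w) \<noteq> 0" if "w \<in> ?S" for w :: complex
    using that by (auto simp: sin_eq_0 mult.commute)
  have ni: "w \<notin> \<int>\<^sub>\<le>\<^sub>0" "1 - w \<notin> \<int>\<^sub>\<le>\<^sub>0" if "w \<in> ?S" for w :: complex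
  proof -
    show "w \<notin> \<int>\<^sub>\<le>\<^sub>0" using that nonpos_Ints_Int by auto
    show "1 - w \<notin> \<int>\<^sub>\<le>\<^sub>0"
    proof
      assume "1 - w \<in> \<int>\<^sub>\<le>\<^sub>0"
      then have "1 - (1 - w) \<in> \<int>" using nonpos_Ints_Int Ints_diff Ints_1 by blast
      then show False using that by simp
    qed
  qed
  have D: "Digamma w - Digamma (1 - w) = - (of_real pi * cos (of_real pi * w) / sin (of_real pi * w))"
    if w: "w \<in> ?S" for w :: complex
  proof -
    have 1: "((\<lambda>w. Gamma w * Gamma (1 - w)) has_field_derivative
        (Gamma w * Gamma (1 - w)) * (Digamma w - Digamma (1 - w))) (at w)"
      using ni[OF w] by (auto intro!: derivative_eq_intros simp: algebra_simps)
    have 2: "((\<lambda>w. of_real pi / sin (of_real pi * w)) has_field_derivative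
        - (of_real pi * (cos (of_real pi * w) * of_real pi) / (sin (of_real pi * w))\<^sup>2)) (at w)"
      using nz[OF w] by (auto intro!: derivative_eq_intros simp: power2_eq_square)
    have "(Gamma w * Gamma (1 - w)) * (Digamma w - Digamma (1 - w)) =
        - (of_real pi * (cos (of_real pi * w) * of_real pi) / (sin (of_real pi * w))\<^sup>2)"
      by (rule DERIV_unique[OF 1]) (use 2 in \<open>simp add: Gamma_reflection_complex\<close>)
    then have eq: "of_real pi / sin (of_real pi * w) * (Digamma w - Digamma (1 - w)) =
        - (of_real pi * (cos (of_real pi * w) * of_real pi) / (sin (of_real pi * w))\<^sup>2)"
      by (simp only: Gamma_reflection_complex)
    have "Digamma w - Digamma (1 - w) = sin (of_real pi * w) / of_real pi *
        (of_real pi / sin (of_real pi * w) * (Digamma w - Digamma (1 - w)))"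
      using nz[OF w] by simp
    then show ?thesis
      unfolding eq using nz[OF w] by (simp add: power2_eq_square)
  qed
  have zS: "z \<in> ?S" using z by simp
  have 1: "((\<lambda>w. Digamma w - Digamma (1 - w)) has_field_derivative
      (Polygamma 1 z + Polygamma 1 (1 - z))) (at z)"
    using ni[OF zS] by (auto intro!: derivative_eq_intros DERIV_chain2[OF has_field_derivative_Polygamma])
  have "((\<lambda>w. - (of_real pi * cos (of_real pi * w) / sin (of_real pi * w))) has_field_derivative
      (of_real pi / sin (of_real pi * z))\<^sup>2 * ((sin (of_real pi * z))\<^sup>2 + (cos (of_real pi * z))\<^sup>2)) (at z)"
    using nz[OF zS] by (auto intro!: derivative_eq_intros simp: power2_eq_square divide_simps)
      (simp add: algebra_simps, use sin_cos_squared_add3[of "z * of_real pi"] in algebra)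
  then have 2: "((\<lambda>w. - (of_real pi * cos (of_real pi * w) / sin (of_real pi * w))) has_field_derivative
      (of_real pi / sin (of_real pi * z))\<^sup>2) (at z)"
    by simp
  have 3: "((\<lambda>w. Digamma w - Digamma (1 - w)) has_field_derivative
      (of_real pi / sin (of_real pi * z))\<^sup>2) (at z)"
    by (rule has_field_derivative_transform_within_open[OF 2 opn zS]) (use D in simp)
  show ?thesis by (rule DERIV_unique[OF 1 3])
qed

section \<open>Sums over the integers and over the points x + 2 pi i l\<close>

lemma has_sum_int:
  fixes f :: "int \<Rightarrow> 'a::topological_comm_monoid_add"
  assumes "((\<lambda>n. f (int n)) has_sum a) UNIV" "((\<lambda>n. f (- 1 - int n)) has_sum b) UNIV"
  shows "(f has_sum (a + b)) UNIV"
proof -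
  have "(f has_sum a) {0..}"
    using assms(1) by (rule has_sum_reindex_bij_witness[of _ nat int, THEN iffD1, rotated -1]) auto
  moreover have "(f has_sum b) {..<0}"
    using assms(2)
    by (rule has_sum_reindex_bij_witness[of _ "\<lambda>l. nat (- 1 - l)" "\<lambda>n. - 1 - int n", THEN iffD1, rotated -1]) auto
  ultimately have "(f has_sum (a + b)) ({0..} \<union> {..<0})"
    by (rule has_sum_Un_disjoint) auto
  moreover have "{0..} \<union> {..<0} = (UNIV :: int set)" by auto
  ultimately show ?thesis by simp
qed

lemma summable_on_int_powr:
  assumes p: "p > 1"
  shows "(\<lambda>l::int. real_of_int \<bar>l\<bar> powr (- p)) summable_on UNIV"
proof -
  have 1: "summable (\<lambda>n. real n powr (- p))" using p by (simp add: summable_real_powr_iff)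
  have "(\<lambda>n. real n powr (- p)) summable_on UNIV"
    using 1 by (intro norm_summable_imp_summable_on) simp
  moreover have "(\<lambda>n. real (Suc n) powr (- p)) summable_on UNIV"
    using 1 summable_Suc_iff[of "\<lambda>n. real n powr (- p)"] by (intro norm_summable_imp_summable_on) simp
  ultimately obtain a b where "((\<lambda>n. real n powr (- p)) has_sum a) UNIV"
    "((\<lambda>n. real (Suc n) powr (- p)) has_sum b) UNIV"
    unfolding summable_on_def by blast
  then have "((\<lambda>l. real_of_int \<bar>l\<bar> powr (- p)) has_sum (a + b)) UNIV"
    by (intro has_sum_int) (simp_all add: add.commute)
  then show ?thesis by (rule has_sum_imp_summable)
qed

text \<open>The majorant \<open>\<bar>l\<bar> powr (- p)\<close> has the value 0 at l = 0, so no
  bound is demanded there and that single term is added separately.\<close>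

lemma summable_on_int_comparison:
  fixes f :: "int \<Rightarrow> real"
  assumes p: "p > 1" and nonneg: "\<And>l. l \<in> A \<Longrightarrow> 0 \<le> f l"
    and le: "\<And>l. l \<in> A \<Longrightarrow> l \<noteq> 0 \<Longrightarrow> f l \<le> K * real_of_int \<bar>l\<bar> powr (- p)"
  shows "f summable_on A"
proof (rule summable_on_comparison_test)
  have "(\<lambda>l::int. if l = 0 then f 0 else 0) summable_on UNIV"
    by (rule finite_nonzero_values_imp_summable_on) (auto intro: finite_subset[of _ "{0}"])
  then have "(\<lambda>l. K * real_of_int \<bar>l\<bar> powr (- p) + (if l = 0 then f 0 else 0)) summable_on UNIV"
    by (intro summable_on_add summable_on_cmult_right summable_on_int_powr p)
  then show "(\<lambda>l. K * real_of_int \<bar>l\<bar> powr (- p) + (if l = 0 then f 0 else 0)) summable_on A"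
    by (rule summable_on_subset_banach) simp
  show "f l \<le> K * real_of_int \<bar>l\<bar> powr (- p) + (if l = 0 then f 0 else 0)" if "l \<in> A" for l
    using le[OF that] by simp
qed (use nonneg in auto)

text \<open>The differences between x and the poles of the kernel, which are the multiples of 2 pi
  i. With x = 2 log k they are the bases of the powers in the double series.\<close>

definition lattice_point :: "real \<Rightarrow> int \<Rightarrow> complex" where
  "lattice_point x l = of_real x + 2 * of_real pi * \<i> * of_int l"

lemma Re_lattice_point [simp]: "Re (lattice_point x l) = x"
  and Im_lattice_point [simp]: "Im (lattice_point x l) = 2 * pi * of_int l"
  by (simp_all add: lattice_point_def)

lemma lattice_point_add: "lattice_point x l + of_real u = lattice_point (x + u) l"
  by (simp add: lattice_point_def)

lemma abs_le_norm_lattice_point: "real_of_int \<bar>l\<bar> \<le> norm (lattice_point x l)"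
proof -
  have "1 * real_of_int \<bar>l\<bar> \<le> 2 * pi * real_of_int \<bar>l\<bar>"
    using pi_ge_two by (intro mult_right_mono) auto
  also have "2 * pi * real_of_int \<bar>l\<bar> \<le> norm (lattice_point x l)"
    using abs_Im_le_cmod[of "lattice_point x l"] by (simp add: abs_mult)
  finally show ?thesis by simp
qed

lemma norm_lattice_point:
  assumes "x \<ge> 0"
  shows "x + real_of_int \<bar>l\<bar> \<le> 2 * norm (lattice_point x l)"
proof -
  have "x \<le> norm (lattice_point x l)" using abs_Re_le_cmod[of "lattice_point x l"] assms by simp
  with abs_le_norm_lattice_point[of l x] show ?thesis by linarith
qed

lemma abs_summable_lattice_point_squares:
  assumes "x \<ge> 0"
  shows "(\<lambda>l. norm (1 / (lattice_point x l)\<^sup>2)) summable_on A"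
\<comment> \<open>The constant 4 is the square of the factor 2 in
  \<open>norm_lattice_point\<close>.\<close>
proof (rule summable_on_int_comparison[of 2 _ _ 4])
  fix l :: int assume l: "l \<noteq> 0"
  have "(real_of_int \<bar>l\<bar>)\<^sup>2 \<le> (2 * norm (lattice_point x l))\<^sup>2"
    using norm_lattice_point[OF assms, of l] assms by (intro power_mono) auto
  moreover have "norm (lattice_point x l) > 0" using norm_lattice_point[OF assms, of l] assms l by linarith
  ultimately show "norm (1 / (lattice_point x l)\<^sup>2) \<le> 4 * real_of_int \<bar>l\<bar> powr - 2"
    using l by (simp add: norm_divide norm_power powr_minus powr_numeral field_simps power_mult_distrib)
qed auto

definition kernel :: "real \<Rightarrow> real" where
  "kernel x = exp (- x) / (1 - exp (- x))\<^sup>2"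

text \<open>With z = x / (2 pi i) the lattice points are 2 pi i (z + l). The terms with l \<ge> 0
  add up to a multiple of \<open>Polygamma 1 z\<close>, those with l < 0 to the same multiple of
  \<open>Polygamma 1 (1 - z)\<close>, and the reflection formula evaluates the total.\<close>

lemma kernel_partial_fractions:
  assumes x: "x > 0"
  shows "((\<lambda>l. 1 / (lattice_point x l)\<^sup>2) has_sum of_real (kernel x)) UNIV"
proof -
  define z :: complex where "z = - \<i> * of_real (x / (2 * pi))"
  have z: "z \<notin> \<int>"
  proof
    assume "z \<in> \<int>"
    then have "Im z = 0" by (auto elim: Ints_cases)
    then show False using x by (simp add: z_def)
  qed
  have z1: "1 - z \<notin> \<int>" using z Ints_diff[of 1 "1 - z"] by auto
  have z0: "z \<noteq> 0" "1 - z \<noteq> 0" using z z1 by auto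
  define c where "c = - (4 * (of_real pi :: complex)\<^sup>2)"
  have c0: "c \<noteq> 0" by (simp add: c_def)
  have lp: "(lattice_point x l)\<^sup>2 = c * (z + of_int l)\<^sup>2" for l
  proof -
    have "lattice_point x l = (2 * of_real pi * \<i>) * (z + of_int l)"
      by (simp add: lattice_point_def z_def complex_eq_iff)
    then show ?thesis by (simp add: power_mult_distrib c_def)
  qed
  have summ: "(\<lambda>l. norm (1 / (lattice_point x l)\<^sup>2)) summable_on UNIV"
    by (rule abs_summable_lattice_point_squares) (use x in simp)
  then have summ': "(\<lambda>l. 1 / (lattice_point x l)\<^sup>2) summable_on UNIV"
    by (rule abs_summable_summable)
  have 1: "((\<lambda>n. 1 / (lattice_point x (int n))\<^sup>2) has_sum (Polygamma 1 z / c)) UNIV"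
  proof -
    have "(\<lambda>n. 1 / (lattice_point x (int n))\<^sup>2) summable_on UNIV"
      using summable_on_subset_banach[OF summ', of "range int"]
      by (simp add: summable_on_reindex o_def)
    then obtain a where a: "((\<lambda>n. 1 / (lattice_point x (int n))\<^sup>2) has_sum a) UNIV"
      unfolding summable_on_def by blast
    \<comment> \<open>The Polygamma series is known as an ordered limit only; the unordered sum
      \<open>a\<close> exists by absolute convergence, and uniqueness of limits identifies the
      two.\<close>
    have "(\<lambda>n. inverse ((z + of_int (int n))\<^sup>2)) sums Polygamma 1 z"
      using Polygamma_LIMSEQ[of z 1] z0 by (simp add: numeral_2_eq_2)
    from sums_divide[OF this, of c] have "(\<lambda>n. 1 / (lattice_point x (int n))\<^sup>2) sums (Polygamma 1 z / c)"
      unfolding lp by (simp add: divide_simps mult.commute)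
    with has_sum_imp_sums[OF a] a show ?thesis using sums_unique2 by blast
  qed
  have 2: "((\<lambda>n. 1 / (lattice_point x (- 1 - int n))\<^sup>2) has_sum (Polygamma 1 (1 - z) / c)) UNIV"
  proof -
    have "(\<lambda>n. 1 / (lattice_point x (- 1 - int n))\<^sup>2) summable_on UNIV"
      using summable_on_subset_banach[OF summ', of "range (\<lambda>n. - 1 - int n)"]
      by (simp add: summable_on_reindex o_def inj_on_def)
    then obtain a where a: "((\<lambda>n. 1 / (lattice_point x (- 1 - int n))\<^sup>2) has_sum a) UNIV"
      unfolding summable_on_def by blast
    have "(\<lambda>n. inverse ((1 - z + of_nat n) ^ Suc 1)) sums Polygamma 1 (1 - z)"
      using Polygamma_LIMSEQ[of "1 - z" 1] z0 by simp
    \<comment> \<open>Numbering the negative integers as -1 - n makes this half the series of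
      \<open>Polygamma 1\<close> at 1 - z, since the square absorbs the sign.\<close>
    moreover have "(z + of_int (- 1 - int n))\<^sup>2 = (1 - z + of_nat n) ^ Suc 1" for n
      by (simp add: power2_eq_square algebra_simps)
    ultimately have "(\<lambda>n. inverse ((z + of_int (- 1 - int n))\<^sup>2)) sums Polygamma 1 (1 - z)"
      by simp
    from sums_divide[OF this, of c]
    have "(\<lambda>n. 1 / (lattice_point x (- 1 - int n))\<^sup>2) sums (Polygamma 1 (1 - z) / c)"
      unfolding lp by (simp add: divide_simps mult.commute)
    with has_sum_imp_sums[OF a] a show ?thesis using sums_unique2 by blast
  qed
  have "Polygamma 1 z / c + Polygamma 1 (1 - z) / c = (Polygamma 1 z + Polygamma 1 (1 - z)) / c"
    by (simp add: add_divide_distrib)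
  also have "\<dots> = (of_real pi / sin (of_real pi * z))\<^sup>2 / c"
    by (subst Polygamma_1_reflection[OF z]) simp
  also have "\<dots> = of_real (kernel x)"
  proof -
    \<comment> \<open>In terms of e^(-x/2) both sin(pi z) = (e^(x/2) - e^(-x/2)) / (2i) and the
      kernel become rational.\<close>
    define E where "E = exp (- x / 2)"
    have E: "E > 0" "E < 1" "exp (- x) = E\<^sup>2" "exp (x / 2) = 1 / E" "exp (- (x / 2)) = E"
      using x by (simp_all add: E_def exp_double[symmetric] exp_minus field_simps)
    have "sin (of_real pi * z) = (of_real (exp (x / 2)) - of_real (exp (- x / 2))) / (2 * \<i>)"
      by (simp add: sin_exp_eq z_def exp_of_real[symmetric] field_simps)
    also have "\<dots> = of_real (1 / E - E) / (2 * \<i>)"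
      by (simp add: E(4,5))
    also have "1 / E - E = (1 - E\<^sup>2) / E"
      using E(1) by (simp add: power2_eq_square field_simps)
    finally have "(sin (of_real pi * z))\<^sup>2 = - of_real ((1 - E\<^sup>2)\<^sup>2 / (4 * E\<^sup>2))"
      by (simp add: power_divide power_mult_distrib)
    then have "(of_real pi / sin (of_real pi * z))\<^sup>2 / c
        = (of_real pi)\<^sup>2 / (- of_real ((1 - E\<^sup>2)\<^sup>2 / (4 * E\<^sup>2))) / c"
      by (simp add: power_divide)
    also have "\<dots> = of_real (pi\<^sup>2 / ((1 - E\<^sup>2)\<^sup>2 / (4 * E\<^sup>2)) / (4 * pi\<^sup>2))"
      by (simp add: c_def)
    also have "pi\<^sup>2 / ((1 - E\<^sup>2)\<^sup>2 / (4 * E\<^sup>2)) / (4 * pi\<^sup>2) = kernel x"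
      using E by (simp add: kernel_def)
    finally show ?thesis .
  qed
  finally show ?thesis using has_sum_int[OF 1 2] by simp
qed

text \<open>The derivative of the geometric series, evaluated at e^(-x).\<close>

lemma kernel_sums:
  assumes x: "x > 0"
  shows "((\<lambda>n. real (Suc n) * exp (- (real (Suc n) * x))) has_sum kernel x) UNIV"
proof -
  have "(\<lambda>n. exp (- x) * (of_nat (Suc n) * exp (- x) ^ n)) sums (exp (- x) * (1 / (1 - exp (- x))\<^sup>2))"
    using x by (intro sums_mult geometric_deriv_sums) simp
  moreover have "exp (- x) * (real (Suc n) * exp (- x) ^ n) = real (Suc n) * exp (- (real (Suc n) * x))" for n
    by (simp add: exp_of_nat_mult[symmetric] algebra_simps exp_add[symmetric])
  ultimately have *: "(\<lambda>n. real (Suc n) * exp (- (real (Suc n) * x))) sums kernel x"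
    by (simp only: kernel_def mult_1_right times_divide_eq_right)
  show ?thesis
    by (rule norm_summable_imp_has_sum[OF _ *]) (use * in \<open>simp add: sums_iff\<close>)
qed

subsection \<open>Mellin transforms of the kernel\<close>

lemma lattice_point_notin_nonpos_Reals:
  assumes "x \<ge> 0" "(x, l) \<noteq> (0, 0)"
  shows "lattice_point x l \<notin> \<real>\<^sub>\<le>\<^sub>0"
  using assms by (auto simp: complex_nonpos_Reals_iff)

lemma integral_lattice_sum:
  assumes b: "0 < b" "b < 1" and w: "w \<ge> 0" and A: "w > 0 \<or> 0 \<notin> A"
  defines "f \<equiv> \<lambda>u. of_real (u powr (b - 1)) * (\<Sum>\<^sub>\<infinity>l\<in>A. 1 / (lattice_point (w + u) l)\<^sup>2)"
  shows "(\<integral>u. f u \<partial>half_line) =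
      of_real (Gamma b * Gamma (2 - b)) * (\<Sum>\<^sub>\<infinity>l\<in>A. lattice_point w l powr of_real (b - 2))"
proof -
  define F where "F l u = of_real (u powr (b - 1)) / (lattice_point w l + of_real u)\<^sup>2" for l u
  have notin: "lattice_point w l \<notin> \<real>\<^sub>\<le>\<^sub>0" if "l \<in> A" for l
    by (rule lattice_point_notin_nonpos_Reals) (use that w A in auto)
  have intF: "integrable half_line (F l)" if "l \<in> A" for l
    unfolding F_def by (rule integrable_half_line_Beta_complex) (use b notin[OF that] in auto)
  have sum1: "(\<lambda>l. \<integral>u. norm (F l u) \<partial>half_line) summable_on A"
  \<comment> \<open>Since |w + u + 2 pi i l| \<ge> (|l| + u) / 2, the absolute integral is at most 4
    times the real Beta integral at x = |l|.\<close>
  proof (rule summable_on_int_comparison[of "2 - b" _ _ "4 * (Gamma b * Gamma (2 - b))"])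
    fix l :: int assume l: "l \<in> A" "l \<noteq> 0"
    have "(\<integral>u. norm (F l u) \<partial>half_line) \<le> (\<integral>u. 4 * (u powr (b - 1) / (real_of_int \<bar>l\<bar> + u)\<^sup>2) \<partial>half_line)"
    proof (rule integral_mono)
      show "integrable half_line (\<lambda>u. norm (F l u))" using intF[OF l(1)] by simp
      show "integrable half_line (\<lambda>u. 4 * (u powr (b - 1) / (real_of_int \<bar>l\<bar> + u)\<^sup>2))"
        by (intro integrable_mult_right integrable_half_line_Beta) (use b l in auto)
      fix u assume "u \<in> space half_line"
      then have u: "u > 0" by simp
      have le: "real_of_int \<bar>l\<bar> + u \<le> 2 * norm (lattice_point (w + u) l)"
        using norm_lattice_point[of "w + u" l] w u by simp
      then have "(real_of_int \<bar>l\<bar> + u)\<^sup>2 \<le> (2 * norm (lattice_point (w + u) l))\<^sup>2"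
        using u by (intro power_mono) auto
      moreover have "norm (lattice_point (w + u) l) > 0" using le u by linarith
      ultimately have "1 / (norm (lattice_point (w + u) l))\<^sup>2 \<le> 4 / (real_of_int \<bar>l\<bar> + u)\<^sup>2"
        using u by (simp add: field_simps power_mult_distrib)
      then have "u powr (b - 1) * (1 / (norm (lattice_point (w + u) l))\<^sup>2)
          \<le> u powr (b - 1) * (4 / (real_of_int \<bar>l\<bar> + u)\<^sup>2)"
        by (intro mult_left_mono) auto
      then show "norm (F l u) \<le> 4 * (u powr (b - 1) / (real_of_int \<bar>l\<bar> + u)\<^sup>2)"
        by (simp add: F_def lattice_point_add norm_divide norm_power mult_ac)
    qed
    also have "\<dots> = 4 * (Gamma b * Gamma (2 - b)) * real_of_int \<bar>l\<bar> powr - (2 - b)"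
      using integral_half_line_Beta[of b "real_of_int \<bar>l\<bar>"] b l
      by (subst integral_mult_right_zero) simp
    finally show "(\<integral>u. norm (F l u) \<partial>half_line)
        \<le> 4 * (Gamma b * Gamma (2 - b)) * real_of_int \<bar>l\<bar> powr - (2 - b)" .
  qed (use b in auto)
  have sum2: "(\<lambda>l. norm (F l u)) summable_on A" if "u \<in> space half_line" for u
  proof -
    have "(\<lambda>l. norm (of_real (u powr (b - 1)) :: complex) * norm (1 / (lattice_point (w + u) l)\<^sup>2)) summable_on A"
      by (intro summable_on_cmult_right abs_summable_lattice_point_squares) (use w that in auto)
    then show ?thesis
      by (simp add: F_def lattice_point_add norm_divide)
  qed
  have *: "(\<Sum>\<^sub>\<infinity>l\<in>A. \<integral>u. F l u \<partial>half_line) = (\<integral>u. (\<Sum>\<^sub>\<infinity>l\<in>A. F l u) \<partial>half_line)"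
    by (rule infsum_integral[OF sigma_finite_half_line countableI_type _ sum1]; erule intF sum2)
  have f: "(\<Sum>\<^sub>\<infinity>l\<in>A. F l u) = f u" for u
    unfolding f_def by (subst infsum_cmult_right'[symmetric]) (simp add: F_def lattice_point_add)
  have "(\<integral>u. f u \<partial>half_line) = (\<Sum>\<^sub>\<infinity>l\<in>A. \<integral>u. F l u \<partial>half_line)"
    using * by (simp add: f)
  also have "\<dots> = (\<Sum>\<^sub>\<infinity>l\<in>A. of_real (Gamma b * Gamma (2 - b)) * lattice_point w l powr of_real (b - 2))"
  proof (rule infsum_cong)
    fix l assume "l \<in> A"
    then show "(\<integral>u. F l u \<partial>half_line) = of_real (Gamma b * Gamma (2 - b)) * lattice_point w l powr of_real (b - 2)"
      unfolding F_def using integral_half_line_Beta_complex[of b "lattice_point w l"] b notin by auto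
  qed
  also have "\<dots> = of_real (Gamma b * Gamma (2 - b)) * (\<Sum>\<^sub>\<infinity>l\<in>A. lattice_point w l powr of_real (b - 2))"
    by (rule infsum_cmult_right')
  finally show "(\<integral>u. f u \<partial>half_line) = \<dots>" .
qed

text \<open>The other evaluation, from the exponential series: the Gamma integral sends the term n
  e^(-n(w+u)) to Gamma(a) n^(1-a) e^(-nw). Stating the summability as a hypothesis covers w > 0 with
  any a > 0 as well as w = 0 with a > 2.\<close>

lemma integral_kernel:
  assumes a: "a > 0" and w: "w \<ge> 0"
    and summ: "(\<lambda>n. real (Suc n) powr (1 - a) * exp (- (real (Suc n) * w))) summable_on UNIV"
  shows "(\<integral>u. u powr (a - 1) * kernel (w + u) \<partial>half_line) =
      Gamma a * (\<Sum>\<^sub>\<infinity>n. real (Suc n) powr (1 - a) * exp (- (real (Suc n) * w)))"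
proof -
  define F where "F n u = (real (Suc n) * exp (- (real (Suc n) * w))) * (u powr (a - 1) * exp (- (real (Suc n) * u)))"
    for n and u :: real
  have intF: "integrable half_line (F n)" for n
    unfolding F_def by (intro integrable_mult_right integrable_half_line_Gamma a) simp
  have IF: "(\<integral>u. F n u \<partial>half_line) = Gamma a * (real (Suc n) powr (1 - a) * exp (- (real (Suc n) * w)))" for n
  proof -
    have "(\<integral>u. F n u \<partial>half_line) = (real (Suc n) * exp (- (real (Suc n) * w))) * (Gamma a * real (Suc n) powr (- a))"
      unfolding F_def using integral_half_line_Gamma[OF a, of "real (Suc n)"] by simp
    moreover have "real (Suc n) powr (1 - a) = real (Suc n) * real (Suc n) powr (- a)"
      by (simp add: powr_diff powr_minus divide_inverse)
    ultimately show ?thesis by simp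
  qed
  have nF: "norm (F n u) = F n u" for n u by (simp add: F_def)
  have hs: "((\<lambda>n. F n u) has_sum (u powr (a - 1) * kernel (w + u))) UNIV" if "u > 0" for u
  proof -
    have "((\<lambda>n. u powr (a - 1) * (real (Suc n) * exp (- (real (Suc n) * (w + u))))) has_sum
        (u powr (a - 1) * kernel (w + u))) UNIV"
      by (intro has_sum_cmult_right kernel_sums) (use that w in simp)
    moreover have "u powr (a - 1) * (real (Suc n) * exp (- (real (Suc n) * (w + u)))) = F n u" for n
      by (simp add: F_def exp_add[symmetric] algebra_simps)
    ultimately show ?thesis by simp
  qed
  have sum1: "(\<lambda>n. \<integral>u. norm (F n u) \<partial>half_line) summable_on UNIV"
    unfolding nF IF by (intro summable_on_cmult_right summ)
  have sum2: "(\<lambda>n. norm (F n u)) summable_on UNIV" if "u \<in> space half_line" for u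
    unfolding nF using hs[of u] that by (auto intro: has_sum_imp_summable)
  have *: "(\<Sum>\<^sub>\<infinity>n. \<integral>u. F n u \<partial>half_line) = (\<integral>u. (\<Sum>\<^sub>\<infinity>n. F n u) \<partial>half_line)"
    by (rule infsum_integral[OF sigma_finite_half_line countableI_type intF sum1]; erule sum2)
  have eq: "(\<Sum>\<^sub>\<infinity>n. F n u) = u powr (a - 1) * kernel (w + u)" if "u \<in> space half_line" for u
    using hs[of u] that by (simp add: infsumI)
  have "(\<integral>u. u powr (a - 1) * kernel (w + u) \<partial>half_line) = (\<integral>u. (\<Sum>\<^sub>\<infinity>n. F n u) \<partial>half_line)"
    by (rule Bochner_Integration.integral_cong) (use eq in auto)
  also have "\<dots> = Gamma a * (\<Sum>\<^sub>\<infinity>n. real (Suc n) powr (1 - a) * exp (- (real (Suc n) * w)))"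
    unfolding *[symmetric] IF by (rule infsum_cmult_right')
  finally show "(\<integral>u. u powr (a - 1) * kernel (w + u) \<partial>half_line) = \<dots>" .
qed

lemma summable_powr_exp:
  fixes p w :: real
  assumes w: "w > 0"
  shows "(\<lambda>n. real (Suc n) powr p * exp (- (real (Suc n) * w))) summable_on UNIV"
proof -
  have "(\<lambda>n. real n powr p * exp (- (real n * w))) \<in> O(\<lambda>n. 1 / real n ^ 2)"
    using w by real_asymp
  moreover have "summable (\<lambda>n. norm (1 / real n ^ 2))"
    using inverse_power_summable[of 2, where 'a = real] by (simp add: divide_inverse)
  ultimately have "summable (\<lambda>n. real n powr p * exp (- (real n * w)))"
    by (rule summable_comparison_test_bigo[rotated])
  then have "summable (\<lambda>n. real (Suc n) powr p * exp (- (real (Suc n) * w)))"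
    by (rule summable_Suc_iff[of "\<lambda>n. real n powr p * exp (- (real n * w))", THEN iffD2])
  then have "summable (\<lambda>n. norm (real (Suc n) powr p * exp (- (real (Suc n) * w))))"
    by simp
  then show ?thesis by (rule norm_summable_imp_summable_on)
qed

text \<open>Comparison of \<open>integral_lattice_sum\<close> and \<open>integral_kernel\<close> for
  b = a = 1 + s; the common positive factor Gamma(1 + s) cancels.\<close>

lemma Lipschitz_formula_real:
  assumes w: "w > 0" and s: "- 1 < s" "s < 0"
  shows "of_real (Gamma (1 - s)) * (\<Sum>\<^sub>\<infinity>l. lattice_point w l powr of_real (s - 1)) =
    of_real (\<Sum>\<^sub>\<infinity>n. real (Suc n) powr (- s) * exp (- (real (Suc n) * w)))"
proof -
  let ?b = "1 + s"
  have b: "0 < ?b" "?b < 1" using s by auto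
  have "of_real (Gamma ?b * Gamma (2 - ?b)) * (\<Sum>\<^sub>\<infinity>l. lattice_point w l powr of_real (?b - 2))
      = (\<integral>u. of_real (u powr (?b - 1)) * (\<Sum>\<^sub>\<infinity>l. 1 / (lattice_point (w + u) l)\<^sup>2) \<partial>half_line)"
    by (rule integral_lattice_sum[symmetric]) (use b w in auto)
  also have "\<dots> = (\<integral>u. complex_of_real (u powr (?b - 1) * kernel (w + u)) \<partial>half_line)"
    by (rule Bochner_Integration.integral_cong)
       (use w kernel_partial_fractions in \<open>auto simp: infsumI\<close>)
  also have "\<dots> = of_real (Gamma ?b * (\<Sum>\<^sub>\<infinity>n. real (Suc n) powr (1 - ?b) * exp (- (real (Suc n) * w))))"
    unfolding integral_complex_of_real
    by (subst integral_kernel) (use b w summable_powr_exp[OF w] in auto)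
  finally show ?thesis
    using Gamma_real_pos[OF b(1)] by simp
qed

section \<open>The kernel without its double pole at 0\<close>

lemma kernel_partial_fractions_nonzero:
  assumes u: "u > 0"
  shows "((\<lambda>l. 1 / (lattice_point u l)\<^sup>2) has_sum of_real (kernel u - 1 / u\<^sup>2)) (- {0})"
proof -
  let ?f = "\<lambda>l. 1 / (lattice_point u l)\<^sup>2"
  have "?f summable_on (- {0})"
    by (rule abs_summable_summable[OF abs_summable_lattice_point_squares]) (use u in simp)
  then obtain T where T: "(?f has_sum T) (- {0})"
    unfolding summable_on_def by blast
  from has_sum_insert[OF _ this, of 0] have "(?f has_sum (?f 0 + T)) (insert 0 (- {0}))"
    by blast
  moreover have "insert 0 (- {0}) = (UNIV :: int set)" by auto
  ultimately have "?f 0 + T = of_real (kernel u)"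
    using has_sum_unique[OF _ kernel_partial_fractions[OF u]] by simp
  then have "T = of_real (kernel u - 1 / u\<^sup>2)"
    by (simp add: lattice_point_def algebra_simps)
  with T show ?thesis by simp
qed

text \<open>Subtracting 1/u^2 only up to u = 1 removes the pole at 0 and keeps the exponential decay
  at infinity. The part cut off contributes the integral of u^(s-2) over (0, 1], that is 1/(s - 1),
  to the Mellin transform.\<close>

definition kernel_regular :: "real \<Rightarrow> real" where
  "kernel_regular u = (if u \<le> 1 then kernel u - 1 / u\<^sup>2 else kernel u)"

lemma kernel_regular_measurable [measurable]: "kernel_regular \<in> borel_measurable borel"
  unfolding kernel_regular_def kernel_def by measurable

lemma kernel_regular_bound:
  obtains K where "K > 0" "\<And>u. u > 0 \<Longrightarrow> \<bar>kernel_regular u\<bar> \<le> K * exp (- u)"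
proof -
  have "(\<lambda>l. 4 * real_of_int \<bar>l\<bar> powr - 2) summable_on (- {0})"
    by (intro summable_on_cmult_right summable_on_subset_banach[OF summable_on_int_powr]) auto
  then obtain C where C: "((\<lambda>l. 4 * real_of_int \<bar>l\<bar> powr - 2) has_sum C) (- {0})"
    unfolding summable_on_def by blast
  have C0: "C \<ge> 0" by (rule has_sum_nonneg[OF C]) simp
  \<comment> \<open>The summand \<open>C * exp 1\<close> serves u \<le> 1, where e^(1-u) \<ge> 1;
    the last summand serves u > 1, where 1 - e^(-u) \<ge> 1 - e^(-1).\<close>
  define K where "K = 1 + C * exp 1 + 1 / (1 - exp (- 1))\<^sup>2"
  have K: "K > 0" using C0 by (simp add: K_def add_pos_nonneg)
  have "\<bar>kernel_regular u\<bar> \<le> K * exp (- u)" if u: "u > 0" for u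
  proof (cases "u \<le> 1")
    case True
    have "norm (of_real (kernel u - 1 / u\<^sup>2) :: complex) \<le> C"
    proof (rule norm_infsum_le[OF kernel_partial_fractions_nonzero[OF u] C])
      fix l :: int assume "l \<in> - {0}"
      then have l: "l \<noteq> 0" by simp
      have le: "real_of_int \<bar>l\<bar> \<le> 2 * norm (lattice_point u l)"
        using norm_lattice_point[of u l] u by simp
      then have "(real_of_int \<bar>l\<bar>)\<^sup>2 \<le> (2 * norm (lattice_point u l))\<^sup>2" by (intro power_mono) auto
      moreover have "norm (lattice_point u l) > 0" using le l by linarith
      ultimately show "norm (1 / (lattice_point u l)\<^sup>2) \<le> 4 * real_of_int \<bar>l\<bar> powr - 2"
        using l by (simp add: norm_divide norm_power powr_minus powr_numeral field_simps power_mult_distrib)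
    qed
    then have "\<bar>kernel_regular u\<bar> \<le> C * 1" using True by (simp add: kernel_regular_def del: of_real_diff)
    also have "\<dots> \<le> C * (exp 1 * exp (- u))"
      using True C0 by (intro mult_left_mono) (auto simp: exp_add[symmetric])
    also have "\<dots> \<le> K * exp (- u)"
      unfolding mult.assoc[symmetric] by (intro mult_right_mono) (auto simp: K_def)
    finally show ?thesis .
  next
    case False
    have "(1 - exp (- 1))\<^sup>2 \<le> (1 - exp (- u))\<^sup>2"
      using False by (intro power_mono) auto
    then have "1 / (1 - exp (- u))\<^sup>2 \<le> 1 / (1 - exp (- 1))\<^sup>2"
      by (intro divide_left_mono) (use u in auto)
    then have "exp (- u) * (1 / (1 - exp (- u))\<^sup>2) \<le> exp (- u) * (1 / (1 - exp (- 1))\<^sup>2)"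
      by (intro mult_left_mono) auto
    also have "\<dots> \<le> exp (- u) * K"
      using C0 by (intro mult_left_mono) (auto simp: K_def)
    finally show ?thesis using False by (simp add: kernel_regular_def kernel_def mult.commute)
  qed
  with K that show thesis by blast
qed

text \<open>In the usual normalisation with u^(s-1) this is the Mellin transform at s + 1, so the
  variable is directly the argument of zeta.\<close>

definition mellin_kernel :: "complex \<Rightarrow> complex" where
  "mellin_kernel s = (\<integral>u. of_real u powr s * of_real (kernel_regular u) \<partial>half_line)"

lemma norm_of_real_powr: "u > 0 \<Longrightarrow> norm (of_real u powr s :: complex) = u powr Re s"
  by (simp add: norm_powr_real_powr)

text \<open>On a disc of radius r about s the power is bounded by the sum of those with the extreme
  exponents Re s - r (for u \<le> 1) and Re s + r (for u > 1). Taking r as half the distance to the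
  line Re s = -1 keeps both Gamma integrals convergent.\<close>

lemma mellin_kernel_dominated:
  assumes s: "Re s > - 1"
  shows "\<exists>r>0. \<exists>G. integrable half_line G \<and>
    (\<forall>y\<in>ball s r. \<forall>u\<in>{0<..}. norm (of_real u powr y * of_real (kernel_regular u) :: complex) \<le> G u)"
proof -
  obtain K where K: "K > 0" "\<And>u. u > 0 \<Longrightarrow> \<bar>kernel_regular u\<bar> \<le> K * exp (- u)"
    using kernel_regular_bound by blast
  define r where "r = (Re s + 1) / 2"
  have r: "r > 0" using s by (simp add: r_def)
  define G where "G u = K * (u powr ((Re s - r + 1) - 1) * exp (- (1 * u)) + u powr ((Re s + r + 1) - 1) * exp (- (1 * u)))"
    for u :: real
  have "integrable half_line G"
    unfolding G_def
    by (intro integrable_mult_right Bochner_Integration.integrable_add integrable_half_line_Gamma)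
       (use s in \<open>auto simp: r_def field_simps\<close>)
  moreover have "norm (of_real u powr y * of_real (kernel_regular u) :: complex) \<le> G u"
    if y: "y \<in> ball s r" and u: "u > 0" for y u
  proof -
    have "\<bar>Re y - Re s\<bar> < r"
      using y abs_Re_le_cmod[of "y - s"] by (simp add: dist_norm norm_minus_commute)
    then have "u powr Re y \<le> u powr (Re s - r) + u powr (Re s + r)"
    proof (cases "u \<le> 1")
      case True
      then have "u powr Re y \<le> u powr (Re s - r)"
        using \<open>\<bar>Re y - Re s\<bar> < r\<close> u by (intro powr_mono') auto
      then show ?thesis by (simp add: add_increasing2)
    next
      case False
      then have "u powr Re y \<le> u powr (Re s + r)"
        using \<open>\<bar>Re y - Re s\<bar> < r\<close> u by (intro powr_mono) auto
      then show ?thesis by (simp add: add_increasing)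
    qed
    then have "u powr Re y * \<bar>kernel_regular u\<bar> \<le> (u powr (Re s - r) + u powr (Re s + r)) * (K * exp (- u))"
      using K(2)[OF u] by (intro mult_mono) auto
    then show ?thesis
      using u by (simp add: G_def norm_mult norm_of_real_powr algebra_simps)
  qed
  ultimately show ?thesis
    using r by (intro exI[of _ r] exI[of _ G] conjI ballI) auto
qed

lemma mellin_kernel_measurable:
  "(\<lambda>u. of_real u powr s * of_real (kernel_regular u) :: complex) \<in> borel_measurable half_line"
proof -
  have "(\<lambda>u. exp (s * of_real (ln u)) * of_real (kernel_regular u) :: complex) \<in> borel_measurable half_line"
    by (intro measurable_restrict_space1) measurable
  then show ?thesis
    by (subst measurable_cong[where g = "\<lambda>u. exp (s * of_real (ln u)) * of_real (kernel_regular u)"])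
       (auto simp: powr_def Ln_of_real)
qed

lemma holomorphic_mellin_kernel: "mellin_kernel holomorphic_on {s. Re s > - 1}"
  unfolding mellin_kernel_def
proof (rule holomorphic_on_integral[OF open_halfspace_Re_gt mellin_kernel_measurable])
  fix s assume "s \<in> {s. - 1 < Re s}"
  then have "Re s > - 1" by simp
  from mellin_kernel_dominated[OF this] obtain r G where "r > 0" "integrable half_line G"
    and le: "\<forall>y\<in>ball s r. \<forall>u\<in>{0<..}. norm (of_real u powr y * of_real (kernel_regular u) :: complex) \<le> G u"
    by (elim exE conjE)
  then show "\<exists>r>0. \<exists>G. integrable half_line G \<and> (\<forall>y\<in>ball s r \<inter> {s. - 1 < Re s}.
      \<forall>u\<in>space half_line. norm (of_real u powr y * of_real (kernel_regular u) :: complex) \<le> G u)"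
    by (intro exI[of _ r] exI[of _ G] conjI ballI le[rule_format]) simp_all
qed (auto intro!: holomorphic_intros)

lemma mellin_kernel_of_real:
  assumes s: "s > - 1"
  shows "integrable half_line (\<lambda>u. u powr s * kernel_regular u)"
    and "mellin_kernel (of_real s) = of_real (\<integral>u. u powr s * kernel_regular u \<partial>half_line)"
proof -
  have eq: "of_real u powr of_real s * of_real (kernel_regular u) = complex_of_real (u powr s * kernel_regular u)"
    if "u \<in> space half_line" for u
    using that by (simp add: powr_of_real)
  have "Re (of_real s) > - 1" using s by simp
  from mellin_kernel_dominated[OF this] obtain r G where "r > 0" and G: "integrable half_line G"
    and le: "\<forall>y\<in>ball (of_real s) r. \<forall>u\<in>{0<..}. norm (of_real u powr y * of_real (kernel_regular u) :: complex) \<le> G u"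
    by (elim exE conjE)
  have "integrable half_line (\<lambda>u. complex_of_real u powr of_real s * of_real (kernel_regular u))"
  proof (rule Bochner_Integration.integrable_bound[OF G mellin_kernel_measurable AE_I2])
    fix u assume "u \<in> space half_line"
    then have "norm (of_real u powr of_real s * of_real (kernel_regular u) :: complex) \<le> G u"
      by (intro le[rule_format]) (use \<open>r > 0\<close> in auto)
    then show "norm (of_real u powr of_real s * of_real (kernel_regular u) :: complex) \<le> norm (G u)" by simp
  qed
  then have "integrable half_line (\<lambda>u. complex_of_real (u powr s * kernel_regular u))"
    by (subst Bochner_Integration.integrable_cong[OF refl eq[symmetric]]) auto
  then show "integrable half_line (\<lambda>u. u powr s * kernel_regular u)"
    by (simp only: complex_of_real_integrable_eq)
  have "mellin_kernel (of_real s) = (\<integral>u. complex_of_real (u powr s * kernel_regular u) \<partial>half_line)"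
    unfolding mellin_kernel_def by (rule Bochner_Integration.integral_cong[OF refl eq])
  then show "mellin_kernel (of_real s) = of_real (\<integral>u. u powr s * kernel_regular u \<partial>half_line)"
    by (simp only: integral_complex_of_real)
qed

lemma
  assumes s: "s > (1::real)"
  shows integrable_powr_below_1: "integrable half_line (\<lambda>u. if u \<le> 1 then u powr (s - 2) else 0)"
    and integral_powr_below_1: "(\<integral>u. (if u \<le> 1 then u powr (s - 2) else 0) \<partial>half_line) = 1 / (s - 1)"
proof -
  let ?f = "\<lambda>u::real. if u \<le> 1 then u powr (s - 2) else 0"
  have "((\<lambda>u. u powr (s - 2)) has_integral (1 powr (s - 2 + 1) / (s - 2 + 1))) {0..1}"
    by (rule has_integral_powr_from_0) (use s in auto)
  then have "(\<integral>\<^sup>+u. ennreal (u powr (s - 2)) * indicator {0..1} u \<partial>lborel) = ennreal (1 / (s - 1))"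
    by (subst nn_integral_has_integral_lebesgue') auto
  also have "(\<integral>\<^sup>+u. ennreal (u powr (s - 2)) * indicator {0..1} u \<partial>lborel)
      = (\<integral>\<^sup>+u. ennreal (?f u) * indicator {0<..} u \<partial>lborel)"
    by (rule nn_integral_cong) (auto simp: indicator_def)
  also have "\<dots> = (\<integral>\<^sup>+u. ennreal (?f u) \<partial>half_line)"
    by (subst nn_integral_restrict_space) auto
  finally have "integrable half_line ?f \<and> integral\<^sup>L half_line ?f = 1 / (s - 1)"
    using s by (subst (asm) nn_integral_eq_integrable) (auto intro!: measurable_restrict_space1)
  then show "integrable half_line ?f" "integral\<^sup>L half_line ?f = 1 / (s - 1)" by auto
qed

text \<open>The value 1/(1 - s) is minus the continuation of \<open>integral_powr_below_1\<close> to
  s < 1. Hence the same term 1/(s - 1) corrects \<open>mellin_kernel\<close> on both sides of the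
  pole.\<close>

lemma
  assumes s: "s < (1::real)"
  shows integrable_powr_above_1: "integrable half_line (\<lambda>u. if u \<le> 1 then 0 else u powr (s - 2))"
    and integral_powr_above_1: "(\<integral>u. (if u \<le> 1 then 0 else u powr (s - 2)) \<partial>half_line) = 1 / (1 - s)"
proof -
  let ?f = "\<lambda>u::real. if u \<le> 1 then 0 else u powr (s - 2)"
  have "((\<lambda>u. u powr (s - 2)) has_integral - (1 powr (s - 2 + 1)) / (s - 2 + 1)) {1..}"
    by (rule has_integral_powr_to_inf) (use s in auto)
  moreover have "- (1 powr (s - 2 + 1)) / (s - 2 + 1) = 1 / (1 - s)"
    using s by (simp add: field_simps)
  ultimately have "(\<integral>\<^sup>+u. ennreal (u powr (s - 2)) * indicator {1..} u \<partial>lborel) = ennreal (1 / (1 - s))"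
    by (subst nn_integral_has_integral_lebesgue') auto
  \<comment> \<open>The integrands differ at u = 1 only, a null set.\<close>
  also have "(\<integral>\<^sup>+u. ennreal (u powr (s - 2)) * indicator {1..} u \<partial>lborel)
      = (\<integral>\<^sup>+u. ennreal (?f u) * indicator {0<..} u \<partial>lborel)"
    by (rule nn_integral_cong_AE, rule AE_mp[OF AE_lborel_singleton[of 1]]) (auto simp: indicator_def)
  also have "\<dots> = (\<integral>\<^sup>+u. ennreal (?f u) \<partial>half_line)"
    by (subst nn_integral_restrict_space) auto
  finally have "integrable half_line ?f \<and> integral\<^sup>L half_line ?f = 1 / (1 - s)"
    using s by (subst (asm) nn_integral_eq_integrable) (auto intro!: measurable_restrict_space1)
  then show "integrable half_line ?f" "integral\<^sup>L half_line ?f = 1 / (1 - s)" by auto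
qed

text \<open>For s > 1 the removed u^(-2) is integrable near 0 against u^s and can be put back; this
  restores the full kernel, which \<open>integral_kernel\<close> evaluates at w = 0.\<close>

lemma mellin_kernel_eq_zeta_series:
  assumes s: "s > (1::real)"
  shows "mellin_kernel (of_real s) + 1 / (of_real s - 1) =
    of_real (Gamma (1 + s) * (\<Sum>\<^sub>\<infinity>n. real (Suc n) powr (- s)))"
proof -
  have "summable (\<lambda>n. real n powr (- s))" using s by (simp add: summable_real_powr_iff)
  then have "summable (\<lambda>n. norm (real (Suc n) powr (- s)))"
    using summable_Suc_iff[of "\<lambda>n. real n powr (- s)"] by simp
  then have summ: "(\<lambda>n. real (Suc n) powr (1 - (1 + s)) * exp (- (real (Suc n) * 0))) summable_on UNIV"
    using norm_summable_imp_summable_on[of "\<lambda>n. real (Suc n) powr (- s)"] by simp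
  have "(\<integral>u. u powr s * kernel_regular u \<partial>half_line) + 1 / (s - 1)
      = (\<integral>u. u powr s * kernel_regular u + (if u \<le> 1 then u powr (s - 2) else 0) \<partial>half_line)"
    using mellin_kernel_of_real(1)[of s] s
    by (subst Bochner_Integration.integral_add)
       (auto intro!: integrable_powr_below_1 simp: integral_powr_below_1)
  also have "\<dots> = (\<integral>u. u powr ((1 + s) - 1) * kernel (0 + u) \<partial>half_line)"
  proof (rule Bochner_Integration.integral_cong[OF refl])
    fix u assume "u \<in> space half_line"
    then show "u powr s * kernel_regular u + (if u \<le> 1 then u powr (s - 2) else 0)
        = u powr ((1 + s) - 1) * kernel (0 + u)"
      by (auto simp: kernel_regular_def powr_diff powr_numeral algebra_simps)
  qed
  also have "\<dots> = Gamma (1 + s) * (\<Sum>\<^sub>\<infinity>n. real (Suc n) powr (1 - (1 + s)) * exp (- (real (Suc n) * 0)))"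
    by (rule integral_kernel[OF _ _ summ]) (use s in auto)
  finally have eq: "(\<integral>u. u powr s * kernel_regular u \<partial>half_line) + 1 / (s - 1)
      = Gamma (1 + s) * (\<Sum>\<^sub>\<infinity>n. real (Suc n) powr (- s))"
    by simp
  have "mellin_kernel (of_real s) + 1 / (of_real s - 1) =
      of_real ((\<integral>u. u powr s * kernel_regular u \<partial>half_line) + 1 / (s - 1))"
    using mellin_kernel_of_real(2)[of s] s by simp
  then show ?thesis by (simp only: eq)
qed

text \<open>For s < 0 one instead subtracts u^(-2) beyond 1 as well. What remains is the partial
  fraction series without l = 0, which \<open>integral_lattice_sum\<close> evaluates at w =
  0.\<close>

lemma mellin_kernel_eq_lattice_sum:
  assumes s: "- 1 < s" "s < (0::real)"
  shows "mellin_kernel (of_real s) + 1 / (of_real s - 1) =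
    of_real (Gamma (1 + s) * Gamma (1 - s)) * (\<Sum>\<^sub>\<infinity>l\<in>-{0}. lattice_point 0 l powr of_real (s - 1))"
proof -
  have "(\<integral>u. u powr s * kernel_regular u \<partial>half_line) - 1 / (1 - s)
      = (\<integral>u. u powr s * kernel_regular u - (if u \<le> 1 then 0 else u powr (s - 2)) \<partial>half_line)"
    using mellin_kernel_of_real(1)[of s] s
    by (subst Bochner_Integration.integral_diff)
       (auto intro!: integrable_powr_above_1 simp: integral_powr_above_1)
  also have "complex_of_real \<dots> = (\<integral>u. complex_of_real (u powr s * kernel_regular u - (if u \<le> 1 then 0 else u powr (s - 2))) \<partial>half_line)"
    by (rule integral_complex_of_real[symmetric])
  also have "\<dots> = (\<integral>u. of_real (u powr ((1 + s) - 1)) * (\<Sum>\<^sub>\<infinity>l\<in>-{0}. 1 / (lattice_point (0 + u) l)\<^sup>2) \<partial>half_line)"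
  proof (rule Bochner_Integration.integral_cong[OF refl])
    fix u assume "u \<in> space half_line"
    then have u: "u > 0" by simp
    have "(\<Sum>\<^sub>\<infinity>l\<in>-{0}. 1 / (lattice_point (0 + u) l)\<^sup>2) = of_real (kernel u - 1 / u\<^sup>2)"
      using kernel_partial_fractions_nonzero[OF u] by (simp add: infsumI)
    moreover have "u powr s * kernel_regular u - (if u \<le> 1 then 0 else u powr (s - 2)) = u powr s * (kernel u - 1 / u\<^sup>2)"
      using u by (auto simp: kernel_regular_def powr_diff powr_numeral algebra_simps)
    ultimately show "complex_of_real (u powr s * kernel_regular u - (if u \<le> 1 then 0 else u powr (s - 2)))
      = of_real (u powr ((1 + s) - 1)) * (\<Sum>\<^sub>\<infinity>l\<in>-{0}. 1 / (lattice_point (0 + u) l)\<^sup>2)"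
      by (simp only: of_real_mult add_diff_cancel_left')
  qed
  also have "\<dots> = of_real (Gamma (1 + s) * Gamma (2 - (1 + s))) *
      (\<Sum>\<^sub>\<infinity>l\<in>-{0}. lattice_point 0 l powr of_real ((1 + s) - 2))"
    by (rule integral_lattice_sum) (use s in auto)
  also have "2 - (1 + s) = 1 - s" by simp
  also have "(1 + s) - 2 = s - 1" by simp
  finally have *: "complex_of_real ((\<integral>u. u powr s * kernel_regular u \<partial>half_line) - 1 / (1 - s)) =
    of_real (Gamma (1 + s) * Gamma (1 - s)) * (\<Sum>\<^sub>\<infinity>l\<in>-{0}. lattice_point 0 l powr of_real (s - 1))" .
  have "1 / (of_real s - 1) = - (1 / (1 - complex_of_real s))"
    using minus_divide_right[of 1 "1 - complex_of_real s"] by simp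
  then have "mellin_kernel (of_real s) + 1 / (of_real s - 1) = complex_of_real ((\<integral>u. u powr s * kernel_regular u \<partial>half_line) - 1 / (1 - s))"
    using s by (subst mellin_kernel_of_real(2)) auto
  with * show ?thesis by simp
qed

subsection \<open>Series depending holomorphically on the exponent\<close>

text \<open>The principal argument lies between -pi and pi, so the phase factor is bounded uniformly
  in z.\<close>

lemma norm_powr_le_exp_Im: "norm (z powr a) \<le> norm z powr Re a * exp (pi * \<bar>Im a\<bar>)"
proof -
  have "\<bar>Arg z\<bar> \<le> pi" using Arg_le_pi[of z] mpi_less_Arg[of z] by linarith
  then have "\<bar>Im a\<bar> * \<bar>Arg z\<bar> \<le> \<bar>Im a\<bar> * pi" by (intro mult_left_mono) auto
  then have "- Im a * Arg z \<le> pi * \<bar>Im a\<bar>"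
    using abs_ge_self[of "- Im a * Arg z"] by (simp add: abs_mult mult.commute)
  then show ?thesis
    unfolding norm_powr_complex by (intro mult_left_mono) auto
qed

text \<open>For bases of norm at least 1 the power grows with the real part of the exponent. The
  radius -Re s / 2 keeps Re s + r negative, so the largest exponent Re s + r - 1 still gives a
  summable majorant.\<close>

lemma lattice_powr_dominated:
  assumes ge1: "\<forall>l\<in>A. norm (lattice_point w l) \<ge> 1" and s: "Re s < 0"
  shows "\<exists>r>0. \<exists>G. G summable_on A \<and>
    (\<forall>y\<in>ball s r. \<forall>l\<in>A. norm (lattice_point w l powr (y - 1)) \<le> G l)"
proof -
  define r where "r = - Re s / 2"
  have r: "r > 0" using s by (simp add: r_def)
  define K where "K = exp (pi * (\<bar>Im s\<bar> + r))"
  define G where "G l = K * norm (lattice_point w l) powr (Re s + r - 1)" for l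
  have "G summable_on A"
    unfolding G_def
  proof (intro summable_on_cmult_right summable_on_int_comparison[of "1 - (Re s + r)" _ _ 1])
    fix l :: int assume l: "l \<noteq> 0"
    have "norm (lattice_point w l) powr (Re s + r - 1) \<le> real_of_int \<bar>l\<bar> powr (Re s + r - 1)"
      using s l abs_le_norm_lattice_point[of l w] by (intro powr_mono2') (auto simp: r_def)
    then show "norm (lattice_point w l) powr (Re s + r - 1) \<le> 1 * real_of_int \<bar>l\<bar> powr - (1 - (Re s + r))"
      by simp
  qed (use s in \<open>auto simp: r_def\<close>)
  moreover have "norm (lattice_point w l powr (y - 1)) \<le> G l" if y: "y \<in> ball s r" and l: "l \<in> A" for y l
  proof -
    have "\<bar>Re y - Re s\<bar> < r" "\<bar>Im y - Im s\<bar> < r"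
      using y abs_Re_le_cmod[of "y - s"] abs_Im_le_cmod[of "y - s"] by (auto simp: dist_norm norm_minus_commute)
    then have "Re (y - 1) \<le> Re s + r - 1" "\<bar>Im (y - 1)\<bar> \<le> \<bar>Im s\<bar> + r" by auto
    then have "norm (lattice_point w l) powr Re (y - 1) * exp (pi * \<bar>Im (y - 1)\<bar>)
        \<le> norm (lattice_point w l) powr (Re s + r - 1) * K"
      unfolding K_def using ge1 l by (intro mult_mono powr_mono) auto
    with norm_powr_le_exp_Im[of "lattice_point w l" "y - 1"] show ?thesis
      by (simp add: G_def mult.commute)
  qed
  ultimately show ?thesis
    using r by (intro exI[of _ r] exI[of _ G] conjI ballI) auto
qed

lemma abs_summable_lattice_powr:
  assumes "\<forall>l\<in>A. norm (lattice_point w l) \<ge> 1" and s: "Re s < 0"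
  shows "(\<lambda>l. norm (lattice_point w l powr (s - 1))) summable_on A"
proof -
  from lattice_powr_dominated[OF assms] obtain r G where r: "r > 0" and G: "G summable_on A"
    and le: "\<forall>y\<in>ball s r. \<forall>l\<in>A. norm (lattice_point w l powr (y - 1)) \<le> G l"
    by (elim exE conjE)
  show ?thesis
    by (rule summable_on_comparison_test[OF G le[rule_format]]) (use r in auto)
qed

lemma holomorphic_lattice_sum:
  assumes ge1: "\<forall>l\<in>A. norm (lattice_point w l) \<ge> 1"
  shows "(\<lambda>s. \<Sum>\<^sub>\<infinity>l\<in>A. lattice_point w l powr (s - 1)) holomorphic_on {s. Re s < 0}"
proof (rule holomorphic_on_infsum[OF open_halfspace_Re_lt])
  fix l assume "l \<in> A"
  then have "lattice_point w l \<noteq> 0" using ge1 by force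
  then show "(\<lambda>s. lattice_point w l powr (s - 1)) holomorphic_on {s. Re s < 0}"
    by (auto intro!: holomorphic_intros)
next
  fix s :: complex assume "s \<in> {s. Re s < 0}"
  then have "Re s < 0" by simp
  from lattice_powr_dominated[OF ge1 this] obtain r G where "r > 0" and "G summable_on A"
    and le: "\<forall>y\<in>ball s r. \<forall>l\<in>A. norm (lattice_point w l powr (y - 1)) \<le> G l"
    by (elim exE conjE)
  then show "\<exists>r>0. \<exists>G. G summable_on A \<and>
      (\<forall>y\<in>ball s r \<inter> {s. Re s < 0}. \<forall>l\<in>A. norm (lattice_point w l powr (y - 1)) \<le> G l)"
    by (intro exI[of _ r] exI[of _ G] conjI ballI le[rule_format]) simp_all
qed

lemma norm_Suc_powr: "norm (of_nat (Suc n) powr s :: complex) = real (Suc n) powr Re s"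
  using norm_of_real_powr[of "real (Suc n)" s] by simp

lemma abs_summable_Dirichlet:
  fixes c :: "nat \<Rightarrow> complex"
  assumes "(\<lambda>n. norm (c n) * real (Suc n) powr (- Re s)) summable_on UNIV"
  shows "(\<lambda>n. norm (c n * of_nat (Suc n) powr (- s))) summable_on UNIV"
  using assms by (simp add: norm_mult norm_Suc_powr del: of_nat_Suc)

text \<open>Absolute convergence at some \<sigma> < Re s dominates the terms on the disc of radius
  Re s - \<sigma> about s, all of whose points lie to the right of \<sigma>.\<close>

lemma holomorphic_Dirichlet:
  fixes c :: "nat \<Rightarrow> complex"
  assumes S: "open S"
    and summ: "\<And>s. s \<in> S \<Longrightarrow> \<exists>\<sigma><Re s. (\<lambda>n. norm (c n) * real (Suc n) powr (- \<sigma>)) summable_on UNIV"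
  shows "(\<lambda>s. \<Sum>\<^sub>\<infinity>n. c n * of_nat (Suc n) powr (- s)) holomorphic_on S"
proof (rule holomorphic_on_infsum[OF S])
  fix s assume "s \<in> S"
  then obtain \<sigma> where \<sigma>: "\<sigma> < Re s" "(\<lambda>n. norm (c n) * real (Suc n) powr (- \<sigma>)) summable_on UNIV"
    using summ by blast
  have "norm (c n * of_nat (Suc n) powr (- y)) \<le> norm (c n) * real (Suc n) powr (- \<sigma>)"
    if y: "y \<in> ball s (Re s - \<sigma>)" for y n
  proof -
    have "\<bar>Re y - Re s\<bar> < Re s - \<sigma>"
      using y abs_Re_le_cmod[of "y - s"] by (auto simp: dist_norm norm_minus_commute)
    then have "real (Suc n) powr Re (- y) \<le> real (Suc n) powr (- \<sigma>)"
      by (intro powr_mono) auto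
    then show ?thesis
      unfolding norm_mult norm_Suc_powr by (intro mult_left_mono) auto
  qed
  then show "\<exists>r>0. \<exists>G. G summable_on UNIV \<and>
      (\<forall>y\<in>ball s r \<inter> S. \<forall>n\<in>UNIV. norm (c n * of_nat (Suc n) powr (- y)) \<le> G n)"
    using \<sigma> by (intro exI[of _ "Re s - \<sigma>"] exI[of _ "\<lambda>n. norm (c n) * real (Suc n) powr (- \<sigma>)"] conjI ballI) auto
qed (auto intro!: holomorphic_intros simp del: of_nat_Suc)

lemma summable_on_Suc_powr:
  assumes "p < - 1"
  shows "(\<lambda>n. real (Suc n) powr p) summable_on UNIV"
proof -
  have "summable (\<lambda>n. real n powr p)" using assms by (simp add: summable_real_powr_iff)
  then have "summable (\<lambda>n. norm (real (Suc n) powr p))"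
    using summable_Suc_iff[of "\<lambda>n. real n powr p"] by simp
  then show ?thesis by (rule norm_summable_imp_summable_on)
qed

lemma one_minus_notin_nonpos_Ints: "Re s < 1 \<Longrightarrow> 1 - s \<notin> \<int>\<^sub>\<le>\<^sub>0"
  by (auto elim!: nonpos_Ints_cases simp: complex_eq_iff)

lemma of_real_infsum:
  fixes f :: "'a \<Rightarrow> real"
  assumes "f summable_on A"
  shows "of_real (infsum f A) = (\<Sum>\<^sub>\<infinity>x\<in>A. of_real (f x) :: complex)"
  by (rule infsumI[OF has_sum_of_real[OF has_sum_infsum[OF assms]], symmetric])

text \<open>Continuation in s of \<open>Lipschitz_formula_real\<close>. The condition w \<ge> 1 puts
  all lattice points outside the open unit disc, as \<open>lattice_powr_dominated\<close> requires;
  the values w = 2 log k with k \<ge> 2 satisfy it.\<close>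

lemma Lipschitz_formula:
  assumes w: "w \<ge> 1" and s: "Re s < 0"
  shows "Gamma (1 - s) * (\<Sum>\<^sub>\<infinity>l. lattice_point w l powr (s - 1)) =
    (\<Sum>\<^sub>\<infinity>n. of_real (exp (- (real (Suc n) * w))) * of_nat (Suc n) powr (- s))"
proof (rule analytic_continuation_real_segment[where S = "{s. Re s < 0}" and a = "- 1" and b = 0 and w = s
      and f = "\<lambda>s. Gamma (1 - s) * (\<Sum>\<^sub>\<infinity>l. lattice_point w l powr (s - 1))"
      and g = "\<lambda>s. \<Sum>\<^sub>\<infinity>n. of_real (exp (- (real (Suc n) * w))) * of_nat (Suc n) powr (- s)"])
  have "1 \<le> norm (lattice_point w l)" for l
    using abs_Re_le_cmod[of "lattice_point w l"] w by simp
  then have ge1: "\<forall>l\<in>UNIV. norm (lattice_point w l) \<ge> 1" by blast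
  show "(\<lambda>s. Gamma (1 - s) * (\<Sum>\<^sub>\<infinity>l. lattice_point w l powr (s - 1))) holomorphic_on {s. Re s < 0}"
    by (intro holomorphic_intros holomorphic_lattice_sum ge1) (use one_minus_notin_nonpos_Ints in auto)
  show "(\<lambda>s. \<Sum>\<^sub>\<infinity>n. of_real (exp (- (real (Suc n) * w))) * of_nat (Suc n) powr (- s)) holomorphic_on {s. Re s < 0}"
  proof (rule holomorphic_Dirichlet[OF open_halfspace_Re_lt])
    fix s :: complex
    \<comment> \<open>The exponential factor gives convergence for every exponent, so Re s - 1 is
      just some abscissa left of s.\<close>
    have "(\<lambda>n. norm (complex_of_real (exp (- (real (Suc n) * w)))) * real (Suc n) powr (- (Re s - 1))) summable_on UNIV"
      using summable_powr_exp[of w "- (Re s - 1)"] w by (simp add: mult.commute)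
    then show "\<exists>\<sigma><Re s. (\<lambda>n. norm (complex_of_real (exp (- (real (Suc n) * w)))) * real (Suc n) powr (- \<sigma>)) summable_on UNIV"
      by (intro exI[of _ "Re s - 1"]) simp
  qed
  fix x :: real assume x: "- 1 < x" "x < 0"
  show "of_real x \<in> {s. Re s < 0}" using x by simp
  have "of_real (\<Sum>\<^sub>\<infinity>n. real (Suc n) powr (- x) * exp (- (real (Suc n) * w))) =
      (\<Sum>\<^sub>\<infinity>n. complex_of_real (real (Suc n) powr (- x) * exp (- (real (Suc n) * w))))"
    by (rule of_real_infsum[OF summable_powr_exp]) (use w in simp)
  also have "\<dots> = (\<Sum>\<^sub>\<infinity>n. of_real (exp (- (real (Suc n) * w))) * of_nat (Suc n) powr (- of_real x))"
  proof (rule infsum_cong)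
    fix n :: nat
    show "complex_of_real (real (Suc n) powr (- x) * exp (- (real (Suc n) * w)))
        = of_real (exp (- (real (Suc n) * w))) * of_nat (Suc n) powr (- of_real x)"
      using powr_of_real[of "real (Suc n)" "- x"] by simp
  qed
  finally show "Gamma (1 - of_real x) * (\<Sum>\<^sub>\<infinity>l. lattice_point w l powr (of_real x - 1)) =
      (\<Sum>\<^sub>\<infinity>n. of_real (exp (- (real (Suc n) * w))) * of_nat (Suc n) powr (- of_real x))"
    using Lipschitz_formula_real[of w x] Gamma_complex_of_real[of "1 - x"] x w by simp
qed (use s in \<open>simp_all add: open_halfspace_Re_lt convex_connected convex_halfspace_Re_lt\<close>)

subsection \<open>The Riemann zeta function\<close>

text \<open>Division by Gamma(1 + s) is written as multiplication by the entire function
  \<open>rGamma\<close>, which leaves s = 1 as the only possible singularity on Re s > -1.\<close>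

definition zeta_right :: "complex \<Rightarrow> complex" where
  "zeta_right s = rGamma (1 + s) * (mellin_kernel s + 1 / (s - 1))"

definition zeta_left :: "complex \<Rightarrow> complex" where
  "zeta_left s = Gamma (1 - s) * (\<Sum>\<^sub>\<infinity>l\<in>-{0}. lattice_point 0 l powr (s - 1))"

lemma norm_lattice_point_0: "\<forall>l\<in>-{0}. norm (lattice_point 0 l) \<ge> 1"
proof
  fix l :: int assume "l \<in> - {0}"
  then have "1 \<le> real_of_int \<bar>l\<bar>" by simp
  then show "norm (lattice_point 0 l) \<ge> 1" using abs_le_norm_lattice_point[of l 0] by linarith
qed

lemma holomorphic_zeta_left: "zeta_left holomorphic_on {s. Re s < 0}"
  unfolding zeta_left_def
  by (intro holomorphic_intros holomorphic_lattice_sum norm_lattice_point_0)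
     (use one_minus_notin_nonpos_Ints in auto)

lemma holomorphic_zeta_right: "zeta_right holomorphic_on {s. Re s > - 1} - {1}"
  unfolding zeta_right_def
  by (intro holomorphic_intros holomorphic_on_subset[OF holomorphic_mellin_kernel]) auto

text \<open>On the real segment of the common strip this is
  \<open>mellin_kernel_eq_lattice_sum\<close>, where the factor Gamma(1 + s) cancels against
  \<open>rGamma\<close>.\<close>

lemma zeta_left_eq_right:
  assumes s: "- 1 < Re s" "Re s < 0"
  shows "zeta_left s = zeta_right s"
proof (rule analytic_continuation_real_segment[where S = "{s. Re s > - 1} \<inter> {s. Re s < 0}" and a = "- 1" and b = 0
      and f = zeta_left and g = zeta_right and w = s])
  show "zeta_left holomorphic_on {s. Re s > - 1} \<inter> {s. Re s < 0}"
    by (rule holomorphic_on_subset[OF holomorphic_zeta_left]) auto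
  show "zeta_right holomorphic_on {s. Re s > - 1} \<inter> {s. Re s < 0}"
    by (rule holomorphic_on_subset[OF holomorphic_zeta_right]) auto
  fix x :: real assume x: "- 1 < x" "x < 0"
  have "Gamma (1 + x) > 0" using x by (intro Gamma_real_pos) simp
  then have Gamma_nz: "Gamma (1 + x) \<noteq> 0" by linarith
  have rGamma_eq: "rGamma (1 + complex_of_real x) = inverse (of_real (Gamma (1 + x)))"
    using Gamma_complex_of_real[of "1 + x"] by (simp add: rGamma_inverse_Gamma)
  have "Gamma (1 - complex_of_real x) = of_real (Gamma (1 - x))"
    using Gamma_complex_of_real[of "1 - x"] by simp
  then show "zeta_left (of_real x) = zeta_right (of_real x)"
    unfolding zeta_right_def mellin_kernel_eq_lattice_sum[OF x] zeta_left_def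
    using Gamma_nz by (simp add: rGamma_eq)
qed (use s in \<open>simp_all add: open_Int open_halfspace_Re_lt open_halfspace_Re_gt convex_connected convex_Int
       convex_halfspace_Re_lt convex_halfspace_Re_gt\<close>)

lemma zeta_right_eq_series:
  assumes s: "Re s > 1"
  shows "zeta_right s = (\<Sum>\<^sub>\<infinity>n. of_nat (Suc n) powr (- s))"
proof (rule analytic_continuation_real_segment[where S = "{s. Re s > 1}" and a = 1 and b = 2
      and f = zeta_right and g = "\<lambda>s. \<Sum>\<^sub>\<infinity>n. of_nat (Suc n) powr (- s)" and w = s])
  show "zeta_right holomorphic_on {s. Re s > 1}"
    by (rule holomorphic_on_subset[OF holomorphic_zeta_right]) auto
  have "(\<lambda>s. \<Sum>\<^sub>\<infinity>n. (1 :: complex) * of_nat (Suc n) powr (- s)) holomorphic_on {s. Re s > 1}"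
  proof (rule holomorphic_Dirichlet[OF open_halfspace_Re_gt])
    fix s :: complex assume "s \<in> {s. 1 < Re s}"
    \<comment> \<open>The midpoint between 1 and Re s is an abscissa left of s that still exceeds
      1.\<close>
    then have "(1 + Re s) / 2 < Re s \<and> (\<lambda>n. norm (1 :: complex) * real (Suc n) powr (- ((1 + Re s) / 2))) summable_on UNIV"
      using summable_on_Suc_powr[of "- ((1 + Re s) / 2)"] by (simp add: field_simps)
    then show "\<exists>\<sigma><Re s. (\<lambda>n. norm (1 :: complex) * real (Suc n) powr (- \<sigma>)) summable_on UNIV"
      by blast
  qed
  then show "(\<lambda>s. \<Sum>\<^sub>\<infinity>n. of_nat (Suc n) powr (- s)) holomorphic_on {s::complex. Re s > 1}"
    by (simp only: mult_1_left)
  fix x :: real assume x: "1 < x" "x < 2"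
  have "Gamma (1 + x) > 0" using x by (intro Gamma_real_pos) simp
  then have Gamma_nz: "Gamma (1 + x) \<noteq> 0" by linarith
  have rGamma_eq: "rGamma (1 + complex_of_real x) = inverse (of_real (Gamma (1 + x)))"
    using Gamma_complex_of_real[of "1 + x"] by (simp add: rGamma_inverse_Gamma)
  have "zeta_right (of_real x) = of_real (\<Sum>\<^sub>\<infinity>n. real (Suc n) powr (- x))"
    unfolding zeta_right_def mellin_kernel_eq_zeta_series[OF x(1)]
    using Gamma_nz by (simp add: rGamma_eq del: of_nat_Suc)
  also have "\<dots> = (\<Sum>\<^sub>\<infinity>n. complex_of_real (real (Suc n) powr (- x)))"
    by (rule of_real_infsum[OF summable_on_Suc_powr]) (use x in simp)
  also have "\<dots> = (\<Sum>\<^sub>\<infinity>n. of_nat (Suc n) powr (- of_real x))"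
  proof (rule infsum_cong)
    fix n :: nat
    show "complex_of_real (real (Suc n) powr (- x)) = of_nat (Suc n) powr (- of_real x)"
      using powr_of_real[of "real (Suc n)" "- x"] by simp
  qed
  finally show "zeta_right (of_real x) = (\<Sum>\<^sub>\<infinity>n. of_nat (Suc n) powr (- of_real x))" .
qed (use s in \<open>simp_all add: open_halfspace_Re_gt convex_connected convex_halfspace_Re_gt\<close>)

lemma abs_summable_zeta_series:
  assumes "Re s > 1"
  shows "(\<lambda>n. norm (of_nat (Suc n) powr (- s) :: complex)) summable_on UNIV"
  using abs_summable_Dirichlet[of "\<lambda>_. 1" s] summable_on_Suc_powr[of "- Re s"] assms by simp

lemma suminf_eq_infsum:
  fixes f :: "nat \<Rightarrow> 'a::banach"
  assumes "(\<lambda>n. norm (f n)) summable_on UNIV"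
  shows "suminf f = infsum f UNIV"
  using has_sum_imp_sums[OF has_sum_infsum[OF abs_summable_summable[OF assms]]] by (simp add: sums_iff)

text \<open>The two representations are holomorphic on overlapping open sets that cover the plane
  without 1, and they agree on the overlap, so they glue. The value at 1 is the normalisation in
  \<open>is_continuation\<close>.\<close>

lemma is_continuation_zeta:
  "is_continuation (\<lambda>s. \<Sum>n. of_nat (Suc n) powr (- s))
     (\<lambda>s. if s = 1 then 0 else if Re s < 0 then zeta_left s else zeta_right s)" (is "is_continuation _ ?f")
  unfolding is_continuation_def
proof (intro conjI allI impI)
  let ?A = "{s. Re s < 0}" and ?B = "{s. Re s > - 1} - {1 :: complex}"
  have "(\<lambda>s. if s \<in> ?A then zeta_left s else zeta_right s) holomorphic_on ?A \<union> ?B"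
    by (rule holomorphic_on_If_Un[OF holomorphic_zeta_left holomorphic_zeta_right])
       (auto intro: open_halfspace_Re_lt open_halfspace_Re_gt zeta_left_eq_right)
  then have "?f holomorphic_on ?A \<union> ?B" by (rule holomorphic_transform) auto
  moreover have "?A \<union> ?B = - {1}" by auto
  ultimately show "?f holomorphic_on - {1}" by simp
  fix s :: complex assume s: "1 < Re s"
  then show "?f s = (\<Sum>n. of_nat (Suc n) powr (- s))"
    using zeta_right_eq_series[OF s] suminf_eq_infsum[OF abs_summable_zeta_series[OF s]]
    by (auto simp del: of_nat_Suc)
qed simp

lemma is_continuation_riemann_zeta:
  "is_continuation (\<lambda>s. \<Sum>n. of_nat (Suc n) powr (- s)) riemann_zeta"
  unfolding riemann_zeta_def continuation_eqI[OF is_continuation_zeta] by (rule is_continuation_zeta)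

lemma riemann_zeta_series:
  assumes "Re s > 1"
  shows "riemann_zeta s = (\<Sum>\<^sub>\<infinity>n. of_nat (Suc n) powr (- s))"
  using is_continuation_riemann_zeta assms suminf_eq_infsum[OF abs_summable_zeta_series[OF assms]]
  by (simp add: is_continuation_def del: of_nat_Suc)

lemma riemann_zeta_lattice:
  assumes "Re s < 0"
  shows "riemann_zeta s = Gamma (1 - s) * (\<Sum>\<^sub>\<infinity>l\<in>-{0}. lattice_point 0 l powr (s - 1))"
proof -
  have "s \<noteq> 1" using assms by auto
  then show ?thesis
    unfolding riemann_zeta_def continuation_eqI[OF is_continuation_zeta]
    using assms by (simp add: zeta_left_def)
qed

section \<open>The lattice sum of the row k = 1 and Riemann's functional equation\<close>

lemma has_sum_nonzero_int:
  fixes f :: "int \<Rightarrow> 'a::topological_comm_monoid_add"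
  assumes "((\<lambda>n. f (int (Suc n))) has_sum a) UNIV" "((\<lambda>n. f (- int (Suc n))) has_sum b) UNIV"
  shows "(f has_sum (a + b)) (- {0})"
proof -
  have "(f has_sum a) {0<..}"
    using assms(1)
    by (rule has_sum_reindex_bij_witness[of _ "\<lambda>l. nat (l - 1)" "\<lambda>n. int (Suc n)", THEN iffD1, rotated -1]) auto
  moreover have "(f has_sum b) {..<0}"
    using assms(2)
    by (rule has_sum_reindex_bij_witness[of _ "\<lambda>l. nat (- 1 - l)" "\<lambda>n. - int (Suc n)", THEN iffD1, rotated -1]) auto
  ultimately have "(f has_sum (a + b)) ({0<..} \<union> {..<0})"
    by (rule has_sum_Un_disjoint) auto
  moreover have "{0<..} \<union> {..<0} = - {0 :: int}" by auto
  ultimately show ?thesis by simp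
qed

text \<open>The terms with l > 0 and with l < 0 add up to (2 pi)^(s-1) i^(s-1) zeta(1 - s) and (2
  pi)^(s-1) (-i)^(s-1) zeta(1 - s). Together with \<open>riemann_zeta_lattice\<close> this is the
  functional equation.\<close>

lemma lattice_sum_eq_chi_factor:
  assumes s: "Re s < 0"
  shows "Gamma (1 - s) * (\<Sum>\<^sub>\<infinity>l\<in>-{0}. lattice_point 0 l powr (s - 1)) = chi_factor s * riemann_zeta (1 - s)"
proof -
  let ?c = "of_real (2 * pi) powr (s - 1) :: complex"
  define Z where "Z = riemann_zeta (1 - s)"
  have "(\<lambda>n. of_nat (Suc n) powr (- (1 - s)) :: complex) summable_on UNIV"
    by (rule abs_summable_summable[OF abs_summable_zeta_series]) (use s in simp)
  then have Z: "((\<lambda>n. of_nat (Suc n) powr (s - 1)) has_sum Z) UNIV"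
    unfolding Z_def using riemann_zeta_series[of "1 - s"] s by (simp add: has_sum_infsum del: of_nat_Suc)
  \<comment> \<open>Principal powers are not multiplicative in general, but a nonnegative real
    factor does not change the argument; so only 2 pi and |l| are split off and the factor i or -i
    is kept.\<close>
  have real_left: "(of_real a * z) powr p = of_real a powr p * z powr p" if "a \<ge> 0" for a :: real and z p :: complex
    by (rule powr_times_real_left) (use that in auto)
  have term_eq: "lattice_point 0 l powr (s - 1) = ?c * \<omega> powr (s - 1) * of_nat (Suc n) powr (s - 1)"
    if "of_int l * \<i> = of_nat (Suc n) * \<omega>" for l n \<omega>
  proof -
    have "lattice_point 0 l = of_real (2 * pi) * (of_real (real (Suc n)) * \<omega>)"
      using that by (simp add: lattice_point_def mult.assoc mult.left_commute[of \<i>] mult.commute[of \<i>])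
    then have "lattice_point 0 l powr (s - 1) = ?c * (of_real (real (Suc n)) powr (s - 1) * \<omega> powr (s - 1))"
      by (simp only: real_left of_nat_0_le_iff mult_nonneg_nonneg pi_ge_zero zero_le_numeral)
    then show ?thesis by simp
  qed
  have "((\<lambda>l. lattice_point 0 l powr (s - 1)) has_sum
      (?c * \<i> powr (s - 1) * Z + ?c * (- \<i>) powr (s - 1) * Z)) (- {0})"
  proof (rule has_sum_nonzero_int)
    have "lattice_point 0 (int (Suc n)) powr (s - 1) = ?c * \<i> powr (s - 1) * of_nat (Suc n) powr (s - 1)" for n
      by (rule term_eq) simp
    then show "((\<lambda>n. lattice_point 0 (int (Suc n)) powr (s - 1)) has_sum ?c * \<i> powr (s - 1) * Z) UNIV"
      using has_sum_cmult_right[OF Z, of "?c * \<i> powr (s - 1)"] by (simp only:)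
    have "lattice_point 0 (- int (Suc n)) powr (s - 1) = ?c * (- \<i>) powr (s - 1) * of_nat (Suc n) powr (s - 1)" for n
      by (rule term_eq) (simp add: algebra_simps)
    then show "((\<lambda>n. lattice_point 0 (- int (Suc n)) powr (s - 1)) has_sum ?c * (- \<i>) powr (s - 1) * Z) UNIV"
      using has_sum_cmult_right[OF Z, of "?c * (- \<i>) powr (s - 1)"] by (simp only:)
  qed
  then have "(\<Sum>\<^sub>\<infinity>l\<in>-{0}. lattice_point 0 l powr (s - 1)) = ?c * (\<i> powr (s - 1) + (- \<i>) powr (s - 1)) * Z"
    by (simp add: infsumI algebra_simps)
  \<comment> \<open>The principal logarithms of i and -i are i pi/2 and -i pi/2, so the sum is 2
    cos(pi (s - 1)/2).\<close>
  also have "\<i> powr (s - 1) + (- \<i>) powr (s - 1) = 2 * sin (of_real pi * s / 2)"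
  proof -
    have "\<i> powr (s - 1) + (- \<i>) powr (s - 1)
        = exp (\<i> * (of_real pi * s / 2 - of_real pi / 2)) + exp (- (\<i> * (of_real pi * s / 2 - of_real pi / 2)))"
      by (simp add: powr_def algebra_simps diff_divide_distrib)
    also have "\<dots> = 2 * cos (of_real pi * s / 2 - of_real pi / 2)"
      by (simp add: cos_exp_eq)
    also have "\<dots> = 2 * sin (of_real pi * s / 2)"
      by (simp add: cos_diff)
    finally show ?thesis .
  qed
  also have "?c = 2 powr (s - 1) * of_real pi powr (s - 1)"
    using real_left[of 2 "of_real pi" "s - 1"] by simp
  also have "2 powr (s - 1) = (2 powr s / 2 :: complex)"
    by (simp add: powr_diff)
  finally show ?thesis
    by (simp add: chi_factor_def Z_def mult_ac)
qed

subsection \<open>The function D\<close>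

text \<open>The term of index n + 1 of the polylogarithm of order s at k^(-2). The power k^(-2(n+1))
  is written as an exponential to match \<open>Lipschitz_formula\<close> at w = 2 log k.\<close>

definition polylog_term :: "complex \<Rightarrow> nat \<Rightarrow> nat \<Rightarrow> complex" where
  "polylog_term s k n = of_real (exp (- (real (Suc n) * (2 * ln (real k))))) * of_nat (Suc n) powr (- s)"

text \<open>One factor k^(-2) is kept for summing over k; in the remaining k^(-2n) the base k is
  replaced by 2. The constant \<open>exp (2 * ln 2)\<close> = 4 compensates for writing 4^(-n) with
  n + 1. This separates the variables.\<close>

lemma norm_polylog_term_le:
  assumes k: "k \<ge> 2"
  shows "norm (polylog_term s k n) \<le> exp (2 * ln 2) * real k powr - 2 *
    (real (Suc n) powr (- Re s) * exp (- (real (Suc n) * (2 * ln 2))))"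
proof -
  have "ln 2 \<le> ln (real k)" using k by simp
  then have "real n * ln 2 \<le> real n * ln (real k)" by (intro mult_left_mono) auto
  then have "- (real (Suc n) * (2 * ln (real k))) \<le> 2 * ln 2 + (- 2 * ln (real k)) + - (real (Suc n) * (2 * ln 2))"
    by (simp add: algebra_simps)
  then have "exp (- (real (Suc n) * (2 * ln (real k)))) \<le> exp (2 * ln 2 + (- 2 * ln (real k)) + - (real (Suc n) * (2 * ln 2)))"
    by (rule exp_le_cancel_iff[THEN iffD2])
  also have "\<dots> = exp (2 * ln 2) * real k powr - 2 * exp (- (real (Suc n) * (2 * ln 2)))"
    unfolding exp_add using k by (simp add: powr_def)
  finally have "exp (- (real (Suc n) * (2 * ln (real k)))) * real (Suc n) powr (- Re s)
      \<le> exp (2 * ln 2) * real k powr - 2 * exp (- (real (Suc n) * (2 * ln 2))) * real (Suc n) powr (- Re s)"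
    by (intro mult_right_mono) auto
  then show ?thesis
    unfolding polylog_term_def norm_mult norm_Suc_powr by (simp add: mult_ac del: of_nat_Suc)
qed

text \<open>The separated majorant is a product of two convergent series for every s. This is the
  absolutely convergent double series on which the exchange of sums is carried out.\<close>

lemma abs_summable_polylog_terms:
  "(\<lambda>(k, n). norm (polylog_term s k n)) summable_on {2..} \<times> UNIV"
proof -
  let ?b = "\<lambda>n. real (Suc n) powr (- Re s) * exp (- (real (Suc n) * (2 * ln 2)))"
  let ?F = "\<lambda>(k, n). exp (2 * ln 2) * real k powr - 2 * ?b n"
  obtain B where B: "(?b has_sum B) UNIV"
    using summable_powr_exp[of "2 * ln 2" "- Re s"] unfolding summable_on_def by auto
  have "summable (\<lambda>k. norm (real k powr - 2))"
    using summable_real_powr_iff[of "- 2"] by simp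
  then have "(\<lambda>k. real k powr - 2) summable_on UNIV"
    by (rule norm_summable_imp_summable_on)
  then have sq: "(\<lambda>k. real k powr - 2) summable_on {2..}"
    by (rule summable_on_subset_banach) simp
  have "?F summable_on {2..} \<times> UNIV"
  proof (rule summable_on_SigmaI)
    show "((\<lambda>n. ?F (k, n)) has_sum (exp (2 * ln 2) * real k powr - 2 * B)) UNIV" for k
      using has_sum_cmult_right[OF B] by simp
    show "(\<lambda>k. exp (2 * ln 2) * real k powr - 2 * B) summable_on {2..}"
      by (intro summable_on_cmult_left summable_on_cmult_right sq)
  qed auto
  then show ?thesis
  proof (rule summable_on_comparison_test)
    fix x :: "nat \<times> nat" assume "x \<in> {2..} \<times> UNIV"
    then obtain k n where x: "x = (k, n)" and k: "k \<ge> 2" by auto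
    show "(case x of (k, n) \<Rightarrow> norm (polylog_term s k n)) \<le> ?F x"
      unfolding x prod.case by (rule norm_polylog_term_le[OF k])
    show "0 \<le> (case x of (k, n) \<Rightarrow> norm (polylog_term s k n))"
      unfolding x prod.case by (rule norm_ge_zero)
  qed
qed

lemma summable_polylog_terms:
  "(\<lambda>(k, n). polylog_term s k n) summable_on {2..} \<times> UNIV"
proof (rule abs_summable_summable)
  have "(\<lambda>x. norm (case x of (k, n) \<Rightarrow> polylog_term s k n)) = (\<lambda>(k, n). norm (polylog_term s k n))"
    by (rule ext) (simp only: case_prod_unfold)
  then show "(\<lambda>x. norm (case x of (k, n) \<Rightarrow> polylog_term s k n)) summable_on {2..} \<times> UNIV"
    using abs_summable_polylog_terms[of s] by (simp only:)
qed

text \<open>By Lipschitz' formula these are the inner lattice sums times Gamma(1 - s), so this gives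
  the absolute convergence of the outer sum, which term-by-term estimates of the lattice series
  cannot give.\<close>

lemma summable_norm_polylog: "(\<lambda>k. norm (\<Sum>\<^sub>\<infinity>n. polylog_term s k n)) summable_on {2..}"
proof (rule summable_on_comparison_test)
  show "(\<lambda>k. \<Sum>\<^sub>\<infinity>n. norm (polylog_term s k n)) summable_on {2..}"
    by (rule summable_on_Sigma_banach[OF abs_summable_polylog_terms])
  fix k :: nat assume "k \<in> {2..}"
  then show "norm (\<Sum>\<^sub>\<infinity>n. polylog_term s k n) \<le> (\<Sum>\<^sub>\<infinity>n. norm (polylog_term s k n))"
    using summable_on_SigmaD1[OF abs_summable_polylog_terms] by (intro norm_infsum_bound) auto
qed simp

section \<open>The entire function E and the continuation of D\<close>

definition zeta_even_excess :: "nat \<Rightarrow> complex" where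
  "zeta_even_excess n = riemann_zeta (2 * of_nat (Suc n)) - 1"

lemma zeta_even_excess_eq:
  "zeta_even_excess n = (\<Sum>\<^sub>\<infinity>k\<in>{2..}. of_real (exp (- (real (Suc n) * (2 * ln (real k))))))"
proof -
  let ?p = "2 * of_nat (Suc n) :: complex"
  let ?f = "\<lambda>k. of_real (exp (- (real (Suc n) * (2 * ln (real k))))) :: complex"
  have Re: "Re ?p > 1" by simp
  have "((\<lambda>m. of_nat (Suc m) powr (- ?p)) has_sum riemann_zeta ?p) UNIV"
    unfolding riemann_zeta_series[OF Re]
    by (rule has_sum_infsum[OF abs_summable_summable[OF abs_summable_zeta_series[OF Re]]])
  moreover have "of_nat (Suc m) powr (- ?p) = ?f (Suc m)" for m
  proof -
    have "of_nat (Suc m) powr (- ?p) = exp (- ?p * of_real (ln (real (Suc m))))"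
      using Ln_of_real[of "real (Suc m)"] by (simp add: powr_def del: of_nat_Suc)
    also have "- ?p * of_real (ln (real (Suc m))) = of_real (- (real (Suc n) * (2 * ln (real (Suc m)))))"
      by (simp add: algebra_simps)
    finally show ?thesis by (simp only: exp_of_real)
  qed
  ultimately have "((\<lambda>m. ?f (Suc m)) has_sum riemann_zeta ?p) UNIV" by (simp only:)
  then have all: "(?f has_sum riemann_zeta ?p) {1..}"
    by (rule has_sum_reindex_bij_witness[of _ "\<lambda>k. k - 1" Suc, THEN iffD1, rotated -1]) auto
  then have "?f summable_on {2..}"
    by (intro summable_on_subset_banach[OF has_sum_imp_summable]) auto
  then obtain T where T: "(?f has_sum T) {2..}"
    unfolding summable_on_def by blast
  \<comment> \<open>The term k = 1 equals 1, as log 1 = 0; it is the 1 subtracted in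
    \<open>zeta_even_excess\<close>.\<close>
  have "(?f has_sum (?f 1 + T)) (insert 1 {2..})"
    by (rule has_sum_insert[OF _ T]) simp
  moreover have "insert 1 {2..} = {1::nat..}" by auto
  ultimately have "(?f has_sum (?f 1 + T)) {1..}" by (simp only:)
  from has_sum_unique[OF this all] have "?f 1 + T = riemann_zeta ?p" .
  then have "T = zeta_even_excess n" by (simp add: zeta_even_excess_def algebra_simps)
  with infsumI[OF T] show ?thesis by simp
qed

lemma zeta_even_excess_times_powr:
  "zeta_even_excess n * of_nat (Suc n) powr (- s) = (\<Sum>\<^sub>\<infinity>k\<in>{2..}. polylog_term s k n)"
  unfolding zeta_even_excess_eq polylog_term_def by (rule infsum_cmult_left'[symmetric])

lemma abs_summable_zeta_even_excess:
  "(\<lambda>n. norm (zeta_even_excess n * of_nat (Suc n) powr (- s))) summable_on UNIV"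
proof (rule summable_on_comparison_test)
  have sw: "(\<lambda>(n, k). norm (polylog_term s k n)) summable_on UNIV \<times> {2..}"
    using abs_summable_polylog_terms[of s] by (subst summable_on_swap) simp
  then show "(\<lambda>n. \<Sum>\<^sub>\<infinity>k\<in>{2..}. norm (polylog_term s k n)) summable_on UNIV"
    by (rule summable_on_Sigma_banach)
  show "norm (zeta_even_excess n * of_nat (Suc n) powr (- s)) \<le> (\<Sum>\<^sub>\<infinity>k\<in>{2..}. norm (polylog_term s k n))" for n
    unfolding zeta_even_excess_times_powr
    using summable_on_SigmaD1[OF sw] by (intro norm_infsum_bound) auto
qed simp

definition E_fun :: "complex \<Rightarrow> complex" where
  "E_fun s = (\<Sum>\<^sub>\<infinity>n. zeta_even_excess n * of_nat (Suc n) powr (- s))"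

lemma holomorphic_E_fun: "E_fun holomorphic_on UNIV"
  unfolding E_fun_def
proof (rule holomorphic_Dirichlet[OF open_UNIV])
  fix s :: complex
  \<comment> \<open>The series converges absolutely at every point, so the shift by 1 is an
    arbitrary choice.\<close>
  have "(\<lambda>n. norm (zeta_even_excess n) * real (Suc n) powr (- (Re s - 1))) summable_on UNIV"
    using abs_summable_zeta_even_excess[of "s - 1"] unfolding norm_mult norm_Suc_powr by simp
  then show "\<exists>\<sigma><Re s. (\<lambda>n. norm (zeta_even_excess n) * real (Suc n) powr (- \<sigma>)) summable_on UNIV"
    by (intro exI[of _ "Re s - 1"]) simp
qed

text \<open>For Re s > 1 the series splits termwise along zeta(2n) = 1 + (zeta(2n) - 1); the two
  parts continue separately.\<close>

lemma is_continuation_D: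
  "is_continuation (\<lambda>s. \<Sum>n. riemann_zeta (2 * of_nat (Suc n)) * of_nat (Suc n) powr (- s))
     (\<lambda>s. if s = 1 then 0 else riemann_zeta s + E_fun s)" (is "is_continuation _ ?f")
  unfolding is_continuation_def
proof (intro conjI allI impI)
  have "riemann_zeta holomorphic_on - {1}"
    using is_continuation_riemann_zeta by (simp add: is_continuation_def)
  then have "(\<lambda>s. riemann_zeta s + E_fun s) holomorphic_on - {1}"
    by (intro holomorphic_intros holomorphic_on_subset[OF holomorphic_E_fun]) auto
  then show "?f holomorphic_on - {1}" by (rule holomorphic_transform) auto
  fix s :: complex assume s: "Re s > 1"
  have "((\<lambda>n. of_nat (Suc n) powr (- s)) has_sum riemann_zeta s) UNIV"
    unfolding riemann_zeta_series[OF s]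
    by (rule has_sum_infsum[OF abs_summable_summable[OF abs_summable_zeta_series[OF s]]])
  moreover have "((\<lambda>n. zeta_even_excess n * of_nat (Suc n) powr (- s)) has_sum E_fun s) UNIV"
    unfolding E_fun_def by (rule has_sum_infsum[OF abs_summable_summable[OF abs_summable_zeta_even_excess]])
  ultimately have "((\<lambda>n. of_nat (Suc n) powr (- s) + zeta_even_excess n * of_nat (Suc n) powr (- s)) has_sum
      (riemann_zeta s + E_fun s)) UNIV"
    by (rule has_sum_add)
  moreover have "of_nat (Suc n) powr (- s) + zeta_even_excess n * of_nat (Suc n) powr (- s)
      = riemann_zeta (2 * of_nat (Suc n)) * of_nat (Suc n) powr (- s)" for n
    unfolding zeta_even_excess_def by (simp add: left_diff_distrib del: of_nat_Suc)
  ultimately have "(\<lambda>n. riemann_zeta (2 * of_nat (Suc n)) * of_nat (Suc n) powr (- s)) sums (riemann_zeta s + E_fun s)"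
    by (intro has_sum_imp_sums) (simp only:)
  then have eq: "riemann_zeta s + E_fun s = (\<Sum>n. riemann_zeta (2 * of_nat (Suc n)) * of_nat (Suc n) powr (- s))"
    by (rule sums_unique)
  have "s \<noteq> 1" using s by auto
  then show "?f s = (\<Sum>n. riemann_zeta (2 * of_nat (Suc n)) * of_nat (Suc n) powr (- s))"
    by (simp only: eq if_False)
qed simp

lemma D_fun_eq:
  assumes "s \<noteq> 1"
  shows "D_fun s = riemann_zeta s + E_fun s"
  unfolding D_fun_def continuation_eqI[OF is_continuation_D] using assms by (simp only: if_False)

section \<open>The rows of the lattice series and the final identities\<close>

lemma lattice_term_eq: "lattice_term s k l = lattice_point (2 * ln (real k)) l powr (s - 1)"
  by (simp add: lattice_term_def lattice_point_def)

lemma norm_lattice_point_log: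
  assumes "k \<ge> 2"
  shows "\<forall>l\<in>UNIV. norm (lattice_point (2 * ln (real k)) l) \<ge> 1"
proof
  fix l
  have "ln 2 \<le> ln (real k)" using assms by simp
  then have "1 \<le> 2 * ln (real k)" using ln2_ge_two_thirds by linarith
  then show "norm (lattice_point (2 * ln (real k)) l) \<ge> 1"
    using abs_Re_le_cmod[of "lattice_point (2 * ln (real k)) l"] by simp
qed

lemma polylog_eq_lattice_sum:
  assumes k: "k \<ge> 2" and s: "Re s < 0"
  shows "(\<Sum>\<^sub>\<infinity>n. polylog_term s k n) = Gamma (1 - s) * (\<Sum>\<^sub>\<infinity>l. lattice_term s k l)"
proof -
  have "ln 2 \<le> ln (real k)" using k by simp
  then have "1 \<le> 2 * ln (real k)" using ln2_ge_two_thirds by linarith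
  from Lipschitz_formula[OF this s] show ?thesis
    by (simp only: polylog_term_def lattice_term_eq)
qed

lemma inner_sum_ge_2:
  assumes "k \<ge> 2"
  shows "inner_sum s k = (\<Sum>\<^sub>\<infinity>l. lattice_term s k l)"
proof -
  have "{l. (k, l) \<noteq> (1, 0 :: int)} = UNIV" using assms by auto
  then show ?thesis by (simp only: inner_sum_def)
qed

lemma inner_sum_1: "inner_sum s 1 = (\<Sum>\<^sub>\<infinity>l\<in>-{0}. lattice_point 0 l powr (s - 1))"
proof -
  have "{l. (1 :: nat, l) \<noteq> (1, 0 :: int)} = - {0}" by auto
  moreover have "lattice_term s 1 l = lattice_point 0 l powr (s - 1)" for l
    by (simp add: lattice_term_eq)
  ultimately show ?thesis by (simp only: inner_sum_def)
qed

theorem theorem3p1: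
  fixes s :: complex
  assumes "Re s < 0"
  shows "(\<forall>k\<ge>1. (\<lambda>l. norm (lattice_term s k l)) summable_on {l. (k, l) \<noteq> (1, 0)})
    \<and> (\<lambda>k. norm (inner_sum s k)) summable_on {1..}
    \<and> D_fun s = Gamma (1 - s) * (\<Sum>\<^sub>\<infinity>k\<in>{1..}. inner_sum s k)
    \<and> D_fun s = chi_factor s * riemann_zeta (1 - s)
        + Gamma (1 - s) * (\<Sum>\<^sub>\<infinity>k\<in>{2..}. \<Sum>\<^sub>\<infinity>l\<in>UNIV. lattice_term s k l)"
proof -
  note s = assms
  have "Gamma (1 - s) \<noteq> 0"
    using one_minus_notin_nonpos_Ints[of s] s by (simp add: Gamma_eq_zero_iff)
  have inner: "(\<lambda>l. norm (lattice_term s k l)) summable_on {l. (k, l) \<noteq> (1, 0)}" if k: "k \<ge> 1" for k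
  proof (cases "k = 1")
    case True
    then have eq: "{l. (k, l) \<noteq> (1, 0 :: int)} = - {0}" by auto
    show ?thesis
      unfolding eq using abs_summable_lattice_powr[OF norm_lattice_point_0 s] True by (simp add: lattice_term_eq)
  next
    case False
    then have eq: "{l. (k, l) \<noteq> (1, 0 :: int)} = UNIV" by auto
    show ?thesis
      unfolding eq using abs_summable_lattice_powr[OF norm_lattice_point_log s] False k by (simp add: lattice_term_eq)
  qed
  have inner_eq: "inner_sum s k = (\<Sum>\<^sub>\<infinity>n. polylog_term s k n) / Gamma (1 - s)" if "k \<in> {2..}" for k
    using polylog_eq_lattice_sum[of k s] inner_sum_ge_2[of k s] that s \<open>Gamma (1 - s) \<noteq> 0\<close> by simp
  have split: "{1..} = insert 1 {2::nat..}" by auto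
  \<comment> \<open>Each row is a polylogarithm divided by the nonzero constant Gamma(1 - s), so its
    size is controlled through the sum over n.\<close>
  have abs2: "(\<lambda>k. norm (inner_sum s k)) summable_on {2..}"
  proof -
    have "(\<lambda>k. norm (\<Sum>\<^sub>\<infinity>n. polylog_term s k n) * inverse (norm (Gamma (1 - s)))) summable_on {2..}"
      by (intro summable_on_cmult_left summable_norm_polylog)
    then show ?thesis
      by (rule summable_on_cong[THEN iffD1, rotated]) (simp add: inner_eq norm_mult norm_inverse divide_inverse)
  qed
  then have abs1: "(\<lambda>k. norm (inner_sum s k)) summable_on {1..}"
    unfolding split by (subst summable_on_insert_iff) auto
  have "E_fun s = (\<Sum>\<^sub>\<infinity>n. \<Sum>\<^sub>\<infinity>k\<in>{2..}. polylog_term s k n)"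
    unfolding E_fun_def zeta_even_excess_times_powr ..
  \<comment> \<open>The sums over k and n are exchanged before the lattice enters: the lattice
    series is not absolutely convergent as a double series, so l takes the place of n only
    afterwards, row by row.\<close>
  also have "\<dots> = (\<Sum>\<^sub>\<infinity>k\<in>{2..}. \<Sum>\<^sub>\<infinity>n. polylog_term s k n)"
    by (rule infsum_swap_banach[OF summable_polylog_terms, symmetric])
  also have "\<dots> = (\<Sum>\<^sub>\<infinity>k\<in>{2..}. Gamma (1 - s) * (\<Sum>\<^sub>\<infinity>l. lattice_term s k l))"
    by (rule infsum_cong, rule polylog_eq_lattice_sum) (use s in auto)
  also have "\<dots> = Gamma (1 - s) * (\<Sum>\<^sub>\<infinity>k\<in>{2..}. \<Sum>\<^sub>\<infinity>l. lattice_term s k l)"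
    by (rule infsum_cmult_right')
  finally have E: "E_fun s = Gamma (1 - s) * (\<Sum>\<^sub>\<infinity>k\<in>{2..}. \<Sum>\<^sub>\<infinity>l. lattice_term s k l)" .
  have "s \<noteq> 1" using s by auto
  \<comment> \<open>Both closing formulas come from this one: the first joins the row k = 1 to the
    others, the second rewrites it by \<open>lattice_sum_eq_chi_factor\<close>.\<close>
  have D: "D_fun s = Gamma (1 - s) * inner_sum s 1 + Gamma (1 - s) * (\<Sum>\<^sub>\<infinity>k\<in>{2..}. \<Sum>\<^sub>\<infinity>l. lattice_term s k l)"
    by (simp only: D_fun_eq[OF \<open>s \<noteq> 1\<close>] riemann_zeta_lattice[OF s] E inner_sum_1)
  have "(\<Sum>\<^sub>\<infinity>k\<in>{2..}. \<Sum>\<^sub>\<infinity>l. lattice_term s k l) = (\<Sum>\<^sub>\<infinity>k\<in>{2..}. inner_sum s k)"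
    by (rule infsum_cong) (simp add: inner_sum_ge_2)
  moreover have "(\<Sum>\<^sub>\<infinity>k\<in>{1..}. inner_sum s k) = inner_sum s 1 + (\<Sum>\<^sub>\<infinity>k\<in>{2..}. inner_sum s k)"
    unfolding split
    by (rule infsumI[OF has_sum_insert[OF _ has_sum_infsum[OF abs_summable_summable[OF abs2]]]]) simp
  ultimately have "D_fun s = Gamma (1 - s) * (\<Sum>\<^sub>\<infinity>k\<in>{1..}. inner_sum s k)"
    using D by (simp add: distrib_left)
  moreover have "D_fun s = chi_factor s * riemann_zeta (1 - s)
        + Gamma (1 - s) * (\<Sum>\<^sub>\<infinity>k\<in>{2..}. \<Sum>\<^sub>\<infinity>l\<in>UNIV. lattice_term s k l)"
    using D by (simp only: inner_sum_1 lattice_sum_eq_chi_factor[OF s])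
  ultimately show ?thesis using inner abs1 by blast
qed

end
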